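(* Let $n\ge 1$ and $0\le m\le n$ be integers, and let $r_1>r_2>\cdots>r_m\ge 0$ and $s_{m+1}>\cdots>s_n\ge 0$ be sequences of non-negative integers such that $-r_j-\tfrac12\ne s_k+\tfrac12$ for all $1\le j\le m$ and $m+1\le k\le n$. Put $\mathbf r=(r_1,\dots,r_m)$, $\mathbf s=(s_{m+1},\dots,s_n)$, and let $G_{\mathbf r,\mathbf s}(q)$ be the coefficient of $t_1^{r_1+\frac12}\cdots t_m^{r_m+\frac12}\,t_{m+1}^{-s_{m+1}-\frac12}\cdots t_n^{-s_n-\frac12}$ in $F(t_1,\dots,t_n)$. Then the series $$\prod_{\substack{1\le j\le m\\ m+1\le k\le n}}\left(1-q^{r_j+s_k+1}\right)\prod_{1\le k<\ell\le m}\left(1-q^{r_k-r_\ell}\right)\prod_{m+1\le k<\ell\le n}\left(1-q^{s_k-s_\ell}\right)\,G_{\mathbf r,\mathbf s}(q)$$ can be written as $$P(q)\sum_{\ell\ge 0}(-1)^\ell q^{\frac{\ell(\ell+1)}2}+Q(q)$$ for unique Laurent polynomials $P$ and $Q$ in $q$.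
   Context: Fermionic Fock space: let $\psi(k+\tfrac12),\psi^*(k+\tfrac12)$, $k\in\mathbb Z$, satisfy $[\psi^*(\ell+\tfrac12),\psi(k+\tfrac12)]_+=\delta_{\ell+k+1,0}$ for $\ell,k\in\mathbb{Z}$, all other anticommutators being zero. $\mathcal F$ is the complex vector space generated from a vacuum vector $\mathbf 1$, annihilated by all $\psi(k+\tfrac12)$ and $\psi^*(k+\tfrac12)$ with $k\ge 0$, with basis the monomials $\psi(-n_a-\tfrac12)\cdots\psi(-n_1-\tfrac12)\psi^*(-m_b-\tfrac12)\cdots\psi^*(-m_1-\tfrac12)\mathbf 1$, where $n_a>\cdots>n_1\ge0$ and $m_b>\cdots>m_1\ge 0$. Such a monomial has charge $a-b$ and is an eigenvector of $L(0)$ with eigenvalue $\sum_i(n_i+\tfrac12)+\sum_i(m_i+\tfrac12)$. $\mathcal F_0$ is the span of the monomials of charge $0$. Let $A(t)=\sum_{\ell\in\mathbb Z}\psi^*(\ell+\tfrac12)\psi(-\ell-\tfrac12)\,t^{-\ell-\frac12}$, and define the Bloch-Okounkov $n$-point function (a formal series in the $t_j$, whose coefficients are power series in $q=e^{2\pi i\tau}$, $|q|<1$) by $$F(t_1,\dots,t_n)=\eta(\tau)\,\mathrm{tr}_{\mathcal F_0}A(t_1)\cdots A(t_n)\,q^{L(0)-\frac1{24}},\qquad \eta(\tau)=q^{\frac1{24}}\prod_{m\ge1}(1-q^m).$$ *)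

theory Defs
  imports
    "HOL-Analysis.Analysis"
    "HOL-Computational_Algebra.Formal_Laurent_Series"
    "HOL-Library.Poly_Mapping"
    "HOL-Library.FSet"
begin

section \<open>Fermionic Fock space\<close>

text \<open>
  Modes are indexed by rationals and only their values at half-integers matter. The monomial
  attached to \<open>N = {n\<^sub>1 < \<dots> < n\<^sub>a}\<close> and \<open>M = {m\<^sub>1 < \<dots> < m\<^sub>b}\<close> is
  \<open>\<psi>(-n\<^sub>a-1/2) \<dots> \<psi>(-n\<^sub>1-1/2) \<psi>\<^sup>*(-m\<^sub>b-1/2) \<dots> \<psi>\<^sup>*(-m\<^sub>1-1/2) \<one>\<close>: \<open>fold\<close> along an
  increasing list applies the operator of the largest index last.
\<close>

definition fock_monomial ::
    "(rat \<Rightarrow> 'v \<Rightarrow> 'v) \<Rightarrow> (rat \<Rightarrow> 'v \<Rightarrow> 'v) \<Rightarrow> 'v \<Rightarrow> nat set \<Rightarrow> nat set \<Rightarrow> 'v" where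
  "fock_monomial \<psi> \<psi>s vac N M =
     fold (\<lambda>n. \<psi> (- of_nat n - 1/2)) (sorted_list_of_set N)
       (fold (\<lambda>m. \<psi>s (- of_nat m - 1/2)) (sorted_list_of_set M) vac)"

locale fermionic_fock = vector_space scale
  for scale :: "complex \<Rightarrow> 'v::ab_group_add \<Rightarrow> 'v" +
  fixes \<psi> \<psi>s :: "rat \<Rightarrow> 'v \<Rightarrow> 'v" and vac :: 'v
  assumes linear_psi: "\<And>k::int. Vector_Spaces.linear scale scale (\<psi> (of_int k + 1/2))"
    and linear_psi_star: "\<And>k::int. Vector_Spaces.linear scale scale (\<psi>s (of_int k + 1/2))"
    and anticomm_star_psi: "\<And>(l::int) (k::int) v.
      \<psi>s (of_int l + 1/2) (\<psi> (of_int k + 1/2) v) + \<psi> (of_int k + 1/2) (\<psi>s (of_int l + 1/2) v)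
        = (if l + k + 1 = 0 then v else 0)"
    and anticomm_psi_psi: "\<And>(l::int) (k::int) v.
      \<psi> (of_int l + 1/2) (\<psi> (of_int k + 1/2) v) + \<psi> (of_int k + 1/2) (\<psi> (of_int l + 1/2) v) = 0"
    and anticomm_star_star: "\<And>(l::int) (k::int) v.
      \<psi>s (of_int l + 1/2) (\<psi>s (of_int k + 1/2) v) + \<psi>s (of_int k + 1/2) (\<psi>s (of_int l + 1/2) v) = 0"
    and psi_vac: "\<And>k::int. k \<ge> 0 \<Longrightarrow> \<psi> (of_int k + 1/2) vac = 0"
    and psi_star_vac: "\<And>k::int. k \<ge> 0 \<Longrightarrow> \<psi>s (of_int k + 1/2) vac = 0"
    and inj_monomials:
      "inj_on (\<lambda>(N, M). fock_monomial \<psi> \<psi>s vac N M) {(N, M). finite N \<and> finite M}"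
    and independent_monomials:
      "independent ((\<lambda>(N, M). fock_monomial \<psi> \<psi>s vac N M) ` {(N, M). finite N \<and> finite M})"
    and span_monomials:
      "span ((\<lambda>(N, M). fock_monomial \<psi> \<psi>s vac N M) ` {(N, M). finite N \<and> finite M}) = UNIV"

definition charge :: "nat set \<Rightarrow> nat set \<Rightarrow> int" where
  "charge N M = int (card N) - int (card M)"

definition energy :: "nat set \<Rightarrow> nat set \<Rightarrow> rat" where
  "energy N M = (\<Sum>n\<in>N. of_nat n + 1/2) + (\<Sum>m\<in>M. of_nat m + 1/2)"

definition charge0_states :: "nat \<Rightarrow> (nat set \<times> nat set) set" where
  "charge0_states d =
     {(N, M). finite N \<and> finite M \<and> charge N M = 0 \<and> energy N M = of_nat d}"

lemma finite_charge0_states: "finite (charge0_states d)"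
proof (rule finite_subset)
  have bound: "n \<le> d" if fin: "finite X" and n: "n \<in> X" and le: "(\<Sum>x\<in>X. of_nat x + 1/2) \<le> (of_nat d :: rat)"
    for n and X :: "nat set"
  proof -
    have "(of_nat n :: rat) + 1/2 \<le> (\<Sum>x\<in>X. of_nat x + 1/2)"
      by (rule member_le_sum[OF n _ fin, of "\<lambda>x. of_nat x + 1/2 :: rat"]) auto
    with le have "(of_nat n :: rat) \<le> of_nat d" by linarith
    then show ?thesis by simp
  qed
  show "charge0_states d \<subseteq> Pow {..d} \<times> Pow {..d}"
  proof (clarsimp simp: charge0_states_def, intro conjI subsetI)
    fix N M :: "nat set" and n
    assume *: "finite N" "finite M" "energy N M = of_nat d"
    have nn: "0 \<le> (\<Sum>n\<in>N. of_nat n + 1/2 :: rat)" "0 \<le> (\<Sum>n\<in>M. of_nat n + 1/2 :: rat)"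
      by (auto intro: sum_nonneg)
    show "n \<in> {..d}" if "n \<in> N"
      using bound[OF *(1) that] *(3) nn by (simp add: energy_def)
    show "n \<in> {..d}" if "n \<in> M"
      using bound[OF *(2) that] *(3) nn by (simp add: energy_def)
  qed
qed simp

lemma charge0_energy_in_Nats:
  assumes "finite N" "finite M" "charge N M = 0"
  shows "energy N M \<in> \<nat>"
proof -
  have c: "card N = card M" using assms by (simp add: charge_def)
  have "energy N M = of_nat (\<Sum>N + \<Sum>M + card M)"
    by (simp add: energy_def sum.distrib c)
  then show ?thesis by (metis of_nat_in_Nats)
qed

section \<open>The n-point function\<close>

context fermionic_fock
begin

abbreviation monomial :: "nat set \<Rightarrow> nat set \<Rightarrow> 'v" where
  "monomial \<equiv> fock_monomial \<psi> \<psi>s vac"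

definition monomials :: "'v set" where
  "monomials = (\<lambda>(N, M). monomial N M) ` {(N, M). finite N \<and> finite M}"

text \<open>
  The coefficient of \<open>t\<^sup>e\<close> in \<open>A(t)\<close>; the summand of index \<open>\<ell>\<close> has \<open>e = -\<ell>-1/2\<close>.
\<close>

definition A_coeff :: "rat \<Rightarrow> 'v \<Rightarrow> 'v" where
  "A_coeff e v = (if \<exists>l::int. e = - of_int l - 1/2 then \<psi>s (- e) (\<psi> e v) else 0)"

text \<open>
  \<open>tr\<^bsub>F\<^sub>0\<^esub> X q\<^bsup>L(0)\<^esup>\<close> as a formal power series in \<open>q\<close>: the coefficient of \<open>q\<^sup>d\<close> is the sum of the
  diagonal matrix entries of \<open>X\<close> over the monomials of charge 0 with \<open>L(0)\<close>-eigenvalue \<open>d\<close>.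
  There are finitely many of these for each \<open>d\<close>, and all \<open>L(0)\<close>-eigenvalues in charge 0 are
  natural numbers.
\<close>

definition trace_charge0 :: "('v \<Rightarrow> 'v) \<Rightarrow> complex fps" where
  "trace_charge0 X = Abs_fps (\<lambda>d. \<Sum>(N, M)\<in>charge0_states d.
     representation monomials (X (monomial N M)) (monomial N M))"

text \<open>
  The coefficient of \<open>t\<^sub>1\<^bsup>e 1\<^esup> \<dots> t\<^sub>n\<^bsup>e n\<^esup>\<close> in \<open>F(t\<^sub>1, \<dots>, t\<^sub>n)\<close>. The factor \<open>q\<^bsup>1/24\<^esup>\<close> of \<open>\<eta>(\<tau>)\<close>
  cancels against the \<open>q\<^bsup>-1/24\<^esup>\<close> in the trace, leaving \<open>\<Prod>\<^bsub>m\<ge>1\<^esub> (1 - q\<^sup>m)\<close>.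
\<close>

definition npoint_coeff :: "nat \<Rightarrow> (nat \<Rightarrow> rat) \<Rightarrow> complex fps" where
  "npoint_coeff n e =
     prodinf (\<lambda>m. 1 - fps_X ^ Suc m) * trace_charge0 (foldr (\<lambda>j. A_coeff (e j)) [1..<Suc n])"

definition G :: "nat \<Rightarrow> nat \<Rightarrow> (nat \<Rightarrow> nat) \<Rightarrow> (nat \<Rightarrow> nat) \<Rightarrow> complex fps" where
  "G n m r s =
     npoint_coeff n (\<lambda>j. if j \<le> m then of_nat (r j) + 1/2 else - of_nat (s j) - 1/2)"

end

definition partial_theta :: "complex fps" where
  "partial_theta = suminf (\<lambda>l. (-1) ^ l * fps_X ^ (l * (l + 1) div 2))"

definition laurent_polynomial :: "complex fls \<Rightarrow> bool" where
  "laurent_polynomial f \<longleftrightarrow> finite {k. fls_nth f k \<noteq> 0}"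

section \<open>Consistency of the Fock space axioms\<close>

text \<open>
  A model: finitely supported functions on the finite sets of occupied modes, where \<open>\<psi>(-n-1/2)\<close>
  creates the mode \<open>n\<close> and \<open>\<psi>\<^sup>*(-m-1/2)\<close> creates the mode \<open>-m-1\<close>. Its monomials are the point masses
  up to a nonzero scalar.
\<close>

type_synonym fock_model = "int fset \<Rightarrow>\<^sub>0 complex"

lift_definition model_scale :: "complex \<Rightarrow> fock_model \<Rightarrow> fock_model" is "\<lambda>c f S. c * f S"
  by (erule rev_finite_subset) auto

definition model_sign :: "int \<Rightarrow> int fset \<Rightarrow> complex" where
  "model_sign i S = (-1) ^ card {j. j |\<in>| S \<and> j < i}"

lift_definition model_create :: "int \<Rightarrow> fock_model \<Rightarrow> fock_model" is
  "\<lambda>i f S. if i |\<in>| S then model_sign i S * f (S |-| {|i|}) else 0"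
proof -
  fix i :: int and f :: "int fset \<Rightarrow> complex"
  assume fin: "finite {S. f S \<noteq> 0}"
  show "finite {S. (if i |\<in>| S then model_sign i S * f (S |-| {|i|}) else 0) \<noteq> 0}"
  proof (rule finite_subset)
    show "{S. (if i |\<in>| S then model_sign i S * f (S |-| {|i|}) else 0) \<noteq> 0} \<subseteq> finsert i ` {S. f S \<noteq> 0}"
    proof (clarsimp split: if_splits)
      fix S assume "i |\<in>| S" "f (S |-| {|i|}) \<noteq> 0"
      then show "S \<in> finsert i ` {S. f S \<noteq> 0}"
        by (intro image_eqI[of _ _ "S |-| {|i|}"]) auto
    qed
  qed (use fin in simp)
qed

lift_definition model_annihilate :: "int \<Rightarrow> fock_model \<Rightarrow> fock_model" is
  "\<lambda>i f S. if i |\<in>| S then 0 else model_sign i S * f (finsert i S)"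
proof -
  fix i :: int and f :: "int fset \<Rightarrow> complex"
  assume fin: "finite {S. f S \<noteq> 0}"
  show "finite {S. (if i |\<in>| S then 0 else model_sign i S * f (finsert i S)) \<noteq> 0}"
  proof (rule finite_subset)
    show "{S. (if i |\<in>| S then 0 else model_sign i S * f (finsert i S)) \<noteq> 0}
            \<subseteq> (\<lambda>S. S |-| {|i|}) ` {S. f S \<noteq> 0}"
    proof (clarsimp split: if_splits)
      fix S assume "i |\<notin>| S" "f (finsert i S) \<noteq> 0"
      then show "S \<in> (\<lambda>S. S |-| {|i|}) ` {S. f S \<noteq> 0}"
        by (intro image_eqI[of _ _ "finsert i S"]) auto
    qed
  qed (use fin in simp)
qed

definition model_psi :: "rat \<Rightarrow> fock_model \<Rightarrow> fock_model" where
  "model_psi x = (let i = \<lfloor>- x\<rfloor> in if i \<ge> 0 then model_create i else model_annihilate i)"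

definition model_psi_star :: "rat \<Rightarrow> fock_model \<Rightarrow> fock_model" where
  "model_psi_star x = (let i = \<lfloor>x\<rfloor> in if i \<ge> 0 then model_annihilate i else model_create i)"

definition model_vac :: fock_model where
  "model_vac = Poly_Mapping.single {||} 1"

lemma floor_half: "\<lfloor>(of_int k + 1/2 :: rat)\<rfloor> = k" "\<lfloor>- (of_int k + 1/2 :: rat)\<rfloor> = - k - 1"
   by linarith+

lemma model_psi_half:
  "model_psi (of_int k + 1/2) =
     (if - k - 1 \<ge> 0 then model_create (- k - 1) else model_annihilate (- k - 1))"
  unfolding model_psi_def Let_def floor_half by simp

lemma model_psi_star_half:
  "model_psi_star (of_int k + 1/2) = (if k \<ge> 0 then model_annihilate k else model_create k)"
  unfolding model_psi_star_def Let_def floor_half by simp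

lemma model_sign_simps [simp]:
  "j |\<notin>| S \<Longrightarrow> model_sign i (finsert j S) = (if j < i then - model_sign i S else model_sign i S)"
  "model_sign i S * model_sign i S = 1"
  "model_sign i S * (model_sign i S * x) = x"
proof -
  assume j: "j |\<notin>| S"
  have fin: "finite {j'. j' |\<in>| S \<and> j' < i}"
    by (rule finite_subset[of _ "fset S"]) auto
  have "{j'. j' |\<in>| finsert j S \<and> j' < i} =
     (if j < i then insert j {j'. j' |\<in>| S \<and> j' < i} else {j'. j' |\<in>| S \<and> j' < i})" by auto
  then show "model_sign i (finsert j S) = (if j < i then - model_sign i S else model_sign i S)"
    using j fin by (simp add: model_sign_def)
next
  show sq: "model_sign i S * model_sign i S = 1"
    by (simp add: model_sign_def flip: power_mult_distrib)
  show "model_sign i S * (model_sign i S * x) = x"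
    using sq by (simp flip: mult.assoc)
qed

lemma model_sign_minus [simp]:
  "j |\<in>| S \<Longrightarrow> model_sign i (S |-| {|j|}) = (if j < i then - model_sign i S else model_sign i S)"
  using model_sign_simps(1)[of j "S |-| {|j|}" i] by (auto simp: finsert_absorb split: if_splits)

lemma model_anticomm:
  "model_create i (model_create j p) + model_create j (model_create i p) = 0"
  "model_annihilate i (model_annihilate j p) + model_annihilate j (model_annihilate i p) = 0"
  "model_annihilate i (model_create j p) + model_create j (model_annihilate i p)
     = (if i = j then p else 0)"
proof -
  have c: "S |-| {|i|} |-| {|j|} = S |-| {|j|} |-| {|i|}" for S :: "int fset" by auto
  have d: "finsert i S |-| {|j|} = finsert i (S |-| {|j|})" if "i \<noteq> j" for S :: "int fset"
    using that by auto
  show "model_create i (model_create j p) + model_create j (model_create i p) = 0"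
    by (rule poly_mapping_eqI) (auto simp: lookup_add model_create.rep_eq c)
  show "model_annihilate i (model_annihilate j p) + model_annihilate j (model_annihilate i p) = 0"
    by (rule poly_mapping_eqI)
      (auto simp: lookup_add model_annihilate.rep_eq finsert_commute[of i j])
  have e: "finsert i (S |-| {|i|}) = S" if "i |\<in>| S" for S :: "int fset" using that by auto
  have f: "finsert i S |-| {|i|} = S" if "i |\<notin>| S" for S :: "int fset" using that by auto
  show "model_annihilate i (model_create j p) + model_create j (model_annihilate i p)
     = (if i = j then p else 0)"
  proof (cases "i = j")
    case True
    show ?thesis unfolding True[symmetric]
    proof (rule poly_mapping_eqI)
      fix S
      show "Poly_Mapping.lookup (model_annihilate i (model_create i p) + model_create i (model_annihilate i p)) S
          = Poly_Mapping.lookup (if i = i then p else 0) S"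
        by (cases "i |\<in>| S")
          (simp_all add: lookup_add model_annihilate.rep_eq model_create.rep_eq e f finsert_absorb)
    qed
  next
    case False
    show ?thesis
    proof (rule poly_mapping_eqI)
      fix S
      show "Poly_Mapping.lookup (model_annihilate i (model_create j p) + model_create j (model_annihilate i p)) S
          = Poly_Mapping.lookup (if i = j then p else 0) S"
        using False by (cases "i |\<in>| S"; cases "j |\<in>| S")
          (simp_all add: lookup_add model_annihilate.rep_eq model_create.rep_eq d)
    qed
  qed
qed

interpretation model: vector_space model_scale
  by standard
    (auto intro!: poly_mapping_eqI simp: model_scale.rep_eq lookup_add algebra_simps)

lemma linear_model:
  "Vector_Spaces.linear model_scale model_scale (model_create i)"
  "Vector_Spaces.linear model_scale model_scale (model_annihilate i)"
  by (unfold_locales;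
      auto intro!: poly_mapping_eqI
        simp: model_scale.rep_eq model_create.rep_eq model_annihilate.rep_eq lookup_add algebra_simps)+

lemma model_create_single:
  "i |\<notin>| S \<Longrightarrow> model_create i (Poly_Mapping.single S c) =
     Poly_Mapping.single (finsert i S) (model_sign i S * c)"
  by (rule poly_mapping_eqI)
     (auto simp: model_create.rep_eq lookup_single when_def)

definition model_key :: "nat set \<Rightarrow> nat set \<Rightarrow> int fset" where
  "model_key N M = Abs_fset (int ` N \<union> (\<lambda>m. - int m - 1) ` M)"

lemma fset_model_key:
  "finite N \<Longrightarrow> finite M \<Longrightarrow> fset (model_key N M) = int ` N \<union> (\<lambda>m. - int m - 1) ` M"
  by (simp add: model_key_def Abs_fset_inverse)

lemma fold_model:
  assumes op: "\<And>x. F x = model_create (h x)" and h: "inj h"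
    and "distinct xs" and "\<And>x. x \<in> set xs \<Longrightarrow> h x |\<notin>| S" and "c \<noteq> 0"
  shows "\<exists>c'. c' \<noteq> 0 \<and> fold F xs (Poly_Mapping.single S c) =
           Poly_Mapping.single (fset_of_list (map h xs) |\<union>| S) c'"
  using assms(3-)
proof (induction xs arbitrary: S c)
  case Nil
  then show ?case by auto
next
  case (Cons x xs)
  have "model_sign (h x) S \<noteq> 0" by (simp add: model_sign_def)
  then have "\<exists>c'. c' \<noteq> 0 \<and> fold F xs (Poly_Mapping.single (finsert (h x) S) (model_sign (h x) S * c)) =
      Poly_Mapping.single (fset_of_list (map h xs) |\<union>| finsert (h x) S) c'"
    using Cons.prems h by (intro Cons.IH) (auto dest: injD)
  then show ?case using Cons.prems
    by (simp add: op[of x] model_create_single)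
qed

lemma model_monomial:
  assumes "finite N" "finite M"
  shows "\<exists>c. c \<noteq> 0 \<and> fock_monomial model_psi model_psi_star model_vac N M
           = Poly_Mapping.single (model_key N M) c"
proof -
  have fl: "\<lfloor>- (- of_nat n - 1/2 :: rat)\<rfloor> = int n" "\<lfloor>(- of_nat n - 1/2 :: rat)\<rfloor> = - int n - 1" for n
    by linarith+
  have 1: "model_psi (- of_nat n - 1/2) = model_create (int n)" for n
    unfolding model_psi_def fl Let_def by simp
  have 2: "model_psi_star (- of_nat n - 1/2) = model_create (- int n - 1)" for n
    unfolding model_psi_star_def fl Let_def by simp
  let ?S = "fset_of_list (map (\<lambda>m. - int m - 1) (sorted_list_of_set M))"
  obtain c where c: "c \<noteq> 0" "fold (\<lambda>m. model_psi_star (- of_nat m - 1/2)) (sorted_list_of_set M) model_vac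
      = Poly_Mapping.single ?S c"
    using fold_model[of "\<lambda>m. model_psi_star (- of_nat m - 1/2)" "\<lambda>m. - int m - 1"
        "sorted_list_of_set M" "{||}" 1, OF 2]
    by (auto simp: model_vac_def inj_def)
  have disj: "int n |\<notin>| ?S" for n
    by (auto simp: fset_of_list_elem simp del: fset_of_list_map)
  obtain c' where "c' \<noteq> 0" "fock_monomial model_psi model_psi_star model_vac N M
      = Poly_Mapping.single (fset_of_list (map int (sorted_list_of_set N)) |\<union>| ?S) c'"
    using fold_model[of "\<lambda>n. model_psi (- of_nat n - 1/2)" int
        "sorted_list_of_set N" ?S c, OF 1 inj_of_nat] c disj
    by (auto simp: fock_monomial_def simp del: fset_of_list_map)
  moreover have "fset_of_list (map int (sorted_list_of_set N)) |\<union>| ?S = model_key N M"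
    using assms by (intro fset_inject[THEN iffD1]) (simp add: fset_model_key fset_of_list.rep_eq)
  ultimately show ?thesis by auto
qed

lemma inj_model_key:
  assumes "finite N" "finite M" "finite N'" "finite M'" "model_key N M = model_key N' M'"
  shows "N = N'" "M = M'"
proof -
  have eq: "int ` N \<union> (\<lambda>m. - int m - 1) ` M = int ` N' \<union> (\<lambda>m. - int m - 1) ` M'"
    using assms fset_model_key by metis
  have 1: "{n. int n \<in> int ` A \<union> (\<lambda>m. - int m - 1) ` B} = A"
   and 2: "{n. - int n - 1 \<in> int ` A \<union> (\<lambda>m. - int m - 1) ` B} = B" for A B by auto
  show "N = N'" using 1[of N M] 1[of N' M'] unfolding eq by simp
  show "M = M'" using 2[of N M] 2[of N' M'] unfolding eq by simp
qed

lemma surj_model_key: "\<exists>N M. finite N \<and> finite M \<and> model_key N M = S"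
proof (intro exI conjI)
  let ?N = "{n. int n \<in> fset S}" and ?M = "{m. - int m - 1 \<in> fset S}"
  show f: "finite ?N" "finite ?M"
    using finite_vimageI[of "fset S" int] finite_vimageI[of "fset S" "\<lambda>m. - int m - 1"]
    by (auto simp: vimage_def inj_def)
  have "x \<in> int ` ?N \<union> (\<lambda>m. - int m - 1) ` ?M" if "x \<in> fset S" for x
  proof (cases "x \<ge> 0")
    case True
    then show ?thesis using that by (auto intro!: image_eqI[of _ _ "nat x"])
  next
    case False
    then show ?thesis using that by (auto intro!: image_eqI[of _ _ "nat (- x - 1)"])
  qed
  then show "model_key ?N ?M = S"
    by (intro fset_inject[THEN iffD1]) (auto simp: fset_model_key[OF f])
qed

theorem fermionic_fock_model:
  "fermionic_fock model_scale model_psi model_psi_star model_vac"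
proof -
  let ?mon = "fock_monomial model_psi model_psi_star model_vac"
  let ?I = "{(N, M). finite N \<and> finite M} :: (nat set \<times> nat set) set"
  let ?B = "(\<lambda>(N, M). ?mon N M) ` ?I"
  obtain c :: "nat set \<Rightarrow> nat set \<Rightarrow> complex" where c: "\<And>N M. finite N \<Longrightarrow> finite M \<Longrightarrow> c N M \<noteq> 0"
      "\<And>N M. finite N \<Longrightarrow> finite M \<Longrightarrow> ?mon N M = Poly_Mapping.single (model_key N M) (c N M)"
    using model_monomial by metis
  have inj: "inj_on (\<lambda>(N, M). ?mon N M) ?I"
  proof (rule inj_onI, clarsimp)
    fix N M N' M' :: "nat set"
    assume fin: "finite N" "finite M" "finite N'" "finite M'" and eq: "?mon N M = ?mon N' M'"
    from eq have "Poly_Mapping.keys (?mon N M) = Poly_Mapping.keys (?mon N' M')" by simp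
    then have "model_key N M = model_key N' M'"
      unfolding c(2)[OF fin(1,2)] c(2)[OF fin(3,4)] using c(1) fin by simp
    then show "N = N' \<and> M = M'" using inj_model_key[OF fin] by simp
  qed
  have ind: "model.independent ?B"
    unfolding model.independent_explicit_module
  proof (intro allI impI)
    fix t u v assume t: "finite t" "t \<subseteq> ?B" "(\<Sum>v\<in>t. model_scale (u v) v) = 0" "v \<in> t"
    then obtain N M where NM: "finite N" "finite M" "v = ?mon N M" by auto
    let ?S = "model_key N M"
    have "Poly_Mapping.lookup w ?S = 0" if w: "w \<in> t" "w \<noteq> v" for w
    proof -
      from w t obtain N' M' where NM': "finite N'" "finite M'" "w = ?mon N' M'" by auto
      then have "model_key N' M' \<noteq> ?S"
        using w NM inj_model_key[OF NM'(1,2) NM(1,2)] by auto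
      then show ?thesis using NM' c by (simp add: lookup_single_not_eq)
    qed
    then have "(\<Sum>w\<in>t. u w * Poly_Mapping.lookup w ?S) = (\<Sum>w\<in>{v}. u w * Poly_Mapping.lookup w ?S)"
      using t by (intro sum.mono_neutral_right) auto
    moreover have "(\<Sum>w\<in>t. u w * Poly_Mapping.lookup w ?S) = 0"
      using arg_cong[OF t(3), of "\<lambda>p. Poly_Mapping.lookup p ?S"] by (simp add: lookup_sum model_scale.rep_eq)
    ultimately show "u v = 0" using NM c by simp
  qed
  have span: "model.span ?B = UNIV"
  proof (intro equalityI subsetI UNIV_I)
    fix p :: fock_model
    have single: "Poly_Mapping.single S a \<in> model.span ?B" for S a
    proof -
      obtain N M where NM: "finite N" "finite M" "model_key N M = S" using surj_model_key by blast
      then have "Poly_Mapping.single S a = model_scale (a / c N M) (?mon N M)"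
        using c by (intro poly_mapping_eqI) (simp add: model_scale.rep_eq lookup_single when_def)
      moreover have "?mon N M \<in> ?B" using NM by auto
      ultimately show ?thesis by (simp add: model.span_base model.span_scale)
    qed
    have "p = (\<Sum>S\<in>Poly_Mapping.keys p. Poly_Mapping.single S (Poly_Mapping.lookup p S))"
      by (rule poly_mapping_eqI)
        (auto simp: lookup_sum lookup_single when_def sum.delta in_keys_iff)
    then show "p \<in> model.span ?B" by (metis (no_types, lifting) single model.span_sum)
  qed
  have vac: "model_annihilate i model_vac = 0" for i
    by (rule poly_mapping_eqI)
      (auto simp: model_annihilate.rep_eq model_vac_def lookup_single when_def)
  show ?thesis
  proof (rule fermionic_fock.intro, rule model.vector_space_axioms, rule fermionic_fock_axioms.intro)
    fix k l :: int and v :: fock_model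
    show "Vector_Spaces.linear model_scale model_scale (model_psi (of_int k + 1/2))"
      unfolding model_psi_half using linear_model by presburger
    show "Vector_Spaces.linear model_scale model_scale (model_psi_star (of_int k + 1/2))"
      unfolding model_psi_star_half using linear_model by presburger
    show "model_psi_star (of_int l + 1/2) (model_psi (of_int k + 1/2) v)
        + model_psi (of_int k + 1/2) (model_psi_star (of_int l + 1/2) v)
        = (if l + k + 1 = 0 then v else 0)"
    proof -
      have "l + k + 1 = 0 \<longleftrightarrow> l = - k - 1" by linarith
      then show ?thesis
        unfolding model_psi_half model_psi_star_half
        using model_anticomm(1)[of l "- k - 1" v] model_anticomm(2)[of l "- k - 1" v]
          model_anticomm(3)[of l "- k - 1" v] model_anticomm(3)[of "- k - 1" l v]
        by (cases "l \<ge> 0"; cases "- k - 1 \<ge> 0") (simp_all add: add.commute)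
    qed
    show "model_psi (of_int l + 1/2) (model_psi (of_int k + 1/2) v)
        + model_psi (of_int k + 1/2) (model_psi (of_int l + 1/2) v) = 0"
      unfolding model_psi_half
      using model_anticomm(1)[of "- l - 1" "- k - 1" v] model_anticomm(2)[of "- l - 1" "- k - 1" v]
        model_anticomm(3)[of "- l - 1" "- k - 1" v] model_anticomm(3)[of "- k - 1" "- l - 1" v]
      by (cases "- l - 1 \<ge> 0"; cases "- k - 1 \<ge> 0") (auto simp: add.commute split: if_splits)
    show "model_psi_star (of_int l + 1/2) (model_psi_star (of_int k + 1/2) v)
        + model_psi_star (of_int k + 1/2) (model_psi_star (of_int l + 1/2) v) = 0"
      unfolding model_psi_star_half
      using model_anticomm(1)[of l k v] model_anticomm(2)[of l k v]
        model_anticomm(3)[of l k v] model_anticomm(3)[of k l v]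
      by (cases "l \<ge> 0"; cases "k \<ge> 0") (auto simp: add.commute split: if_splits)
    show "model_psi (of_int k + 1/2) model_vac = 0" if "k \<ge> 0"
      unfolding model_psi_half using that vac by simp
    show "model_psi_star (of_int k + 1/2) model_vac = 0" if "k \<ge> 0"
      unfolding model_psi_star_half using that vac by simp
  qed (fact inj ind span)+
qed

end

theory Submission
  imports Defs
begin

text \<open>
  Each coefficient of \<open>A(t)\<close> is diagonal in the monomial basis: it is the projection onto the
  monomials whose Maya diagram has no particle at a prescribed site \<open>x\<close>. Hence \<open>G\<close> is
  \<open>\<Prod>\<^sub>m (1 - q\<^sup>m)\<close> times the generating function \<open>T(I)\<close> of the charge 0 diagrams that are vacant on a set
  \<open>I\<close> of \<open>n\<close> sites. Up to truncation \<open>T(I)\<close> is an elementary symmetric function of the powers \<open>q\<^sup>x\<close>,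
  \<open>x \<notin> I\<close>, so that \<open>(q\<^sup>b - q\<^sup>a) T(I \<union> {a, b}) = q\<^sup>b T(I \<union> {b}) - q\<^sup>a T(I \<union> {a})\<close>. This partial fraction
  recursion reduces the claim to \<open>n = 1\<close>, where the q-binomial theorem gives
  \<open>\<Prod>\<^sub>m (1 - q\<^sup>m) T({x}) = \<Sum>\<^sub>l (-1)\<^sup>l q\<^bsup>x l + l (l + 1) / 2\<^esup>\<close>, a shifted partial theta series. Uniqueness
  holds because the gaps in the exponents of the partial theta series are unbounded.
\<close>

unbundle no vec_syntax
unbundle fps_syntax

section \<open>Monomials and orders of vanishing of Laurent series\<close>

definition qpow :: "int \<Rightarrow> complex fls" where
  "qpow x = fls_shift (- x) 1"

lemma qpow_nth: "qpow x $$ d = (if d = x then 1 else 0)"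
  by (auto simp: qpow_def)

lemma qpow_0 [simp]: "qpow 0 = 1"
  by (simp add: qpow_def)

lemma qpow_add: "qpow (x + y) = qpow x * qpow y"
  by (simp add: qpow_def fls_X_intpow_times_fls_X_intpow)

lemma qpow_mult_nth: "(qpow x * f) $$ d = f $$ (d - x)"
  by (simp add: qpow_def fls_X_intpow_times_conv_shift)

lemma qpow_cancel [simp]: "qpow x * (qpow (- x) * f) = f" "qpow (- x) * (qpow x * f) = f"
  by (simp_all flip: mult.assoc qpow_add)

lemma fps_to_fls_X_power: "fps_to_fls (fps_X ^ k) = qpow (int k)"
  by (auto simp: fls_eq_iff qpow_nth fps_X_power_nth)

lemma fps_to_fls_prod: "fps_to_fls (\<Prod>i\<in>A. f i) = (\<Prod>i\<in>A. fps_to_fls (f i))"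
  by (induction A rule: infinite_finite_induct) (simp_all add: fls_times_fps_to_fls)

text \<open>The relation \<open>f = O(q^n)\<close>. It is phrased through coefficients because the
  zero series has \<open>fls_subdegree\<close> 0.\<close>

definition vanishes_below :: "int \<Rightarrow> complex fls \<Rightarrow> bool" where
  "vanishes_below n f \<longleftrightarrow> (\<forall>d<n. f $$ d = 0)"

lemma vanishes_below_mono: "vanishes_below n f \<Longrightarrow> m \<le> n \<Longrightarrow> vanishes_below m f"
  by (auto simp: vanishes_below_def)

lemma vanishes_below_add: "vanishes_below n f \<Longrightarrow> vanishes_below n g \<Longrightarrow> vanishes_below n (f + g)"
  and vanishes_below_diff: "vanishes_below n f \<Longrightarrow> vanishes_below n g \<Longrightarrow> vanishes_below n (f - g)"
  and vanishes_below_uminus: "vanishes_below n f \<Longrightarrow> vanishes_below n (- f)"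
  by (auto simp: vanishes_below_def)

lemma vanishes_below_sum:
  "(\<And>x. x \<in> A \<Longrightarrow> vanishes_below n (f x)) \<Longrightarrow> vanishes_below n (\<Sum>x\<in>A. f x)"
  by (simp add: vanishes_below_def fls_nth_sum)

lemma vanishes_below_mult:
  assumes "vanishes_below a f" "vanishes_below b g"
  shows "vanishes_below (a + b) (f * g)"
  unfolding vanishes_below_def
proof (intro allI impI)
  fix d assume d: "d < a + b"
  have "f $$ i * g $$ (d - i) = 0" for i
    using assms d unfolding vanishes_below_def by (cases "i < a") auto
  then show "(f * g) $$ d = 0"
    unfolding fls_times_nth(2) by (intro sum.neutral) blast
qed

lemma vanishes_below_qpow: "vanishes_below x (qpow x)"
  by (simp add: vanishes_below_def qpow_nth)

lemma vanishes_below_qpow_mult: "vanishes_below n f \<Longrightarrow> vanishes_below (x + n) (qpow x * f)"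
  by (intro vanishes_below_mult vanishes_below_qpow)

lemma vanishes_below_fps: "vanishes_below 0 (fps_to_fls f)"
  by (simp add: vanishes_below_def)

text \<open>The difference \<open>f - g\<close> does not depend on \<open>B\<close>, so errors of
  order \<open>B - c\<close> for all large \<open>B\<close> force equality. The constant
  \<open>c\<close> leaves room for multiplication by fixed powers of \<open>q\<close>.\<close>

lemma eq_if_vanishes_below:
  assumes "\<And>B::nat. B \<ge> B0 \<Longrightarrow> vanishes_below (int B - c) (f - g)"
  shows "f = g"
proof (rule fls_eqI)
  fix d
  have "vanishes_below (int (max B0 (nat (d + c + 1))) - c) (f - g)"
    by (rule assms) simp
  then have "(f - g) $$ d = 0"
    by (simp add: vanishes_below_def)
  then show "f $$ d = g $$ d" by simp
qed

section \<open>Closure properties of Laurent polynomials\<close>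

lemma laurent_polynomial_finite_superset:
  "finite S \<Longrightarrow> (\<And>k. f $$ k \<noteq> 0 \<Longrightarrow> k \<in> S) \<Longrightarrow> laurent_polynomial f"
  unfolding laurent_polynomial_def by (rule finite_subset[of _ S]) auto

lemma laurent_polynomial_0 [simp]: "laurent_polynomial 0"
  by (simp add: laurent_polynomial_def)

lemma laurent_polynomial_qpow [simp]: "laurent_polynomial (qpow x)"
  by (rule laurent_polynomial_finite_superset[of "{x}"]) (auto simp: qpow_nth split: if_splits)

lemma laurent_polynomial_1 [simp]: "laurent_polynomial 1"
  using laurent_polynomial_qpow[of 0] by simp

lemma laurent_polynomial_uminus: "laurent_polynomial f \<Longrightarrow> laurent_polynomial (- f)"
  by (simp add: laurent_polynomial_def)

lemma laurent_polynomial_add: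
  assumes "laurent_polynomial f" "laurent_polynomial g"
  shows "laurent_polynomial (f + g)"
  using assms unfolding laurent_polynomial_def[of f] laurent_polynomial_def[of g]
  by (intro laurent_polynomial_finite_superset[of "{k. f $$ k \<noteq> 0} \<union> {k. g $$ k \<noteq> 0}"]) auto

lemma laurent_polynomial_diff:
  "laurent_polynomial f \<Longrightarrow> laurent_polynomial g \<Longrightarrow> laurent_polynomial (f - g)"
  using laurent_polynomial_add[OF _ laurent_polynomial_uminus, of f g] by simp

lemma laurent_polynomial_mult:
  assumes "laurent_polynomial f" "laurent_polynomial g"
  shows "laurent_polynomial (f * g)"
proof (rule laurent_polynomial_finite_superset)
  let ?S = "(\<lambda>(i, j). i + j) ` ({k. f $$ k \<noteq> 0} \<times> {k. g $$ k \<noteq> 0})"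
  show "finite ?S" using assms by (simp add: laurent_polynomial_def)
  fix k assume "(f * g) $$ k \<noteq> 0"
  then obtain i where "f $$ i * g $$ (k - i) \<noteq> 0"
    unfolding fls_times_nth(2) by (meson sum.neutral)
  then show "k \<in> ?S" by (intro image_eqI[of _ _ "(i, k - i)"]) auto
qed

lemma laurent_polynomial_prod:
  "(\<And>i. i \<in> A \<Longrightarrow> laurent_polynomial (f i)) \<Longrightarrow> laurent_polynomial (\<Prod>i\<in>A. f i)"
  by (induction A rule: infinite_finite_induct) (auto intro: laurent_polynomial_mult)

text \<open>A Laurent polynomial is the finite sum of its monomials, each of which shifts
  \<open>g\<close>. The range of summation is then independent of \<open>d\<close>.\<close>

lemma mult_nth_finite_support:
  assumes "finite S" "\<And>k. f $$ k \<noteq> 0 \<Longrightarrow> k \<in> S"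
  shows "((f :: complex fls) * g) $$ d = (\<Sum>k\<in>S. f $$ k * g $$ (d - k))"
proof -
  have "f = (\<Sum>k\<in>S. fls_const (f $$ k) * qpow k)"
  proof (rule fls_eqI)
    fix d
    have "(\<Sum>k\<in>S. fls_const (f $$ k) * qpow k) $$ d = (\<Sum>k\<in>S. if d = k then f $$ k else 0)"
      by (auto simp: fls_nth_sum qpow_nth intro!: sum.cong)
    also have "\<dots> = f $$ d" using assms by (auto simp: sum.delta')
    finally show "f $$ d = (\<Sum>k\<in>S. fls_const (f $$ k) * qpow k) $$ d" by simp
  qed
  then have "f * g = (\<Sum>k\<in>S. fls_const (f $$ k) * (qpow k * g))"
    by (metis (no_types, lifting) sum.cong sum_distrib_right mult.assoc)
  then show ?thesis by (simp add: fls_nth_sum qpow_mult_nth)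
qed

section \<open>The partial theta function\<close>

definition tri :: "nat \<Rightarrow> nat" where
  "tri l = l * (l + 1) div 2"

lemma tri_0 [simp]: "tri 0 = 0"
  and tri_Suc: "tri (Suc l) = tri l + Suc l"
  by (simp_all add: tri_def)

lemma strict_mono_tri: "strict_mono tri"
  by (rule strict_mono_Suc_iff[THEN iffD2]) (simp add: tri_Suc)

lemma tri_ge: "l \<le> tri l"
  using strict_mono_tri by (rule strict_mono_imp_increasing)

text \<open>Since \<open>l \<le> tri l\<close>, the terms beyond \<open>d\<close> do not reach the
  coefficient of \<open>q^d\<close>; the partial sums stabilise coefficientwise and so converge as
  formal power series.\<close>

lemma partial_theta_nth: "partial_theta $ d = (\<Sum>l\<le>d. if tri l = d then (-1) ^ l else 0)"
proof -
  let ?f = "\<lambda>l. (-1) ^ l * fps_X ^ tri l :: complex fps"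
  have nth: "?f l $ d = (if tri l = d then (-1) ^ l else 0)" for l d
    by (cases "even l") (auto simp: fps_X_power_nth)
  let ?g = "Abs_fps (\<lambda>d. \<Sum>l\<le>d. if tri l = d then (-1) ^ l else 0) :: complex fps"
  have "?f sums ?g"
    unfolding sums_def
  proof (rule tendsto_fpsI)
    fix d
    have "(\<Sum>l<n. ?f l) $ d = ?g $ d" if "n > d" for n
      unfolding fps_sum_nth nth fps_nth_Abs_fps
      using that tri_ge by (intro sum.mono_neutral_right) (auto simp: not_le dest: leD)
    then show "\<forall>\<^sub>F n in sequentially. (\<Sum>l<n. ?f l) $ d = ?g $ d"
      unfolding eventually_sequentially by (intro exI[of _ "Suc d"]) simp
  qed
  then have "suminf ?f = ?g" by (rule sums_unique[symmetric])
  then show ?thesis by (simp add: partial_theta_def tri_def)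
qed

lemma partial_theta_nth_tri: "partial_theta $ tri l = (-1) ^ l"
proof -
  have "(\<Sum>k\<le>tri l. if tri k = tri l then (-1) ^ k else 0 :: complex) =
      (\<Sum>k\<le>tri l. if k = l then (-1) ^ k else 0)"
    by (intro sum.cong) (auto dest: strict_mono_eq[OF strict_mono_tri, THEN iffD1])
  then show ?thesis using tri_ge[of l] by (simp add: partial_theta_nth)
qed

lemma partial_theta_nth_0: "(\<And>l. d \<noteq> tri l) \<Longrightarrow> partial_theta $ d = 0"
  unfolding partial_theta_nth by (intro sum.neutral) metis

abbreviation \<theta> :: "complex fls" where
  "\<theta> \<equiv> fps_to_fls partial_theta"

text \<open>The lowest term of \<open>R\<close> times the \<open>l\<close>-th term of \<open>\<theta>\<close> cannot cancel once the gap \<open>l\<close> between consecutive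
  exponents of \<open>\<theta>\<close> exceeds the width of \<open>R\<close>.\<close>

lemma laurent_mult_theta_imp_zero:
  assumes R: "laurent_polynomial R" and Rt: "laurent_polynomial (R * \<theta>)"
  shows "R = 0"
proof (rule ccontr)
  assume "R \<noteq> 0"
  let ?S = "{k. R $$ k \<noteq> 0}"
  define a b where "a = Min ?S" and "b = Max ?S"
  have fin: "finite ?S" "finite {k. (R * \<theta>) $$ k \<noteq> 0}"
    using R Rt by (simp_all add: laurent_polynomial_def)
  have ne: "?S \<noteq> {}" using \<open>R \<noteq> 0\<close> by (auto simp: fls_eq_iff)
  have ab: "a \<in> ?S" "\<And>k. k \<in> ?S \<Longrightarrow> a \<le> k \<and> k \<le> b"
    using fin ne Min_in[OF fin(1) ne] by (auto simp: a_def b_def)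
  have "(R * \<theta>) $$ (a + int (tri (Suc l))) \<noteq> 0" if l: "int l \<ge> b - a" for l
  proof -
    have zero: "\<theta> $$ (a + int (tri (Suc l)) - k) = 0" if k: "k \<in> ?S - {a}" for k
    proof -
      have k': "a < k" "k \<le> b" using ab k by force+
      let ?d = "a + int (tri (Suc l)) - k"
      have "nat ?d \<noteq> tri j" for j
      proof
        assume "nat ?d = tri j"
        \<comment> \<open>Here \<open>0 < k - a \<le> b - a \<le> l\<close>, while
          \<open>tri (Suc l)\<close> exceeds \<open>tri l\<close> by \<open>Suc l\<close>.\<close>
        moreover have "tri l < nat ?d" "nat ?d < tri (Suc l)"
          using k' l by (simp_all add: tri_Suc)
        ultimately show False
          using strict_mono_less[OF strict_mono_tri, of l j]
            strict_mono_less[OF strict_mono_tri, of j "Suc l"] by simp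
      qed
      then show ?thesis by (simp add: partial_theta_nth_0)
    qed
    have "(R * \<theta>) $$ (a + int (tri (Suc l))) = (\<Sum>k\<in>?S. R $$ k * \<theta> $$ (a + int (tri (Suc l)) - k))"
      by (rule mult_nth_finite_support) (use fin in auto)
    also have "\<dots> = (\<Sum>k\<in>{a}. R $$ k * \<theta> $$ (a + int (tri (Suc l)) - k))"
      using fin ab zero by (intro sum.mono_neutral_right) auto
    also have "\<dots> = R $$ a * (-1) ^ Suc l" by (simp add: partial_theta_nth_tri del: power_Suc)
    finally show ?thesis using ab by auto
  qed
  then have "(\<lambda>l. a + int (tri (Suc l))) ` {nat (b - a)..} \<subseteq> {k. (R * \<theta>) $$ k \<noteq> 0}"
    by auto
  then have "finite ((\<lambda>l. a + int (tri (Suc l))) ` {nat (b - a)..})"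
    using fin(2) finite_subset by blast
  moreover have "inj_on (\<lambda>l. a + int (tri (Suc l))) {nat (b - a)..}"
    using strict_mono_eq[OF strict_mono_tri] by (auto simp: inj_on_def)
  ultimately show False using finite_imageD infinite_Ici by blast
qed

section \<open>The module over Laurent polynomials spanned by \<open>\<theta>\<close> and
  \<open>1\<close>\<close>

definition theta_module :: "complex fls set" where
  "theta_module = {P * \<theta> + Q | P Q. laurent_polynomial P \<and> laurent_polynomial Q}"

lemma theta_module_diff:
  assumes "f \<in> theta_module" "g \<in> theta_module"
  shows "f - g \<in> theta_module"
proof -
  obtain P Q P' Q' where "f = P * \<theta> + Q" "g = P' * \<theta> + Q'" "laurent_polynomial P"
    "laurent_polynomial Q" "laurent_polynomial P'" "laurent_polynomial Q'"
    using assms by (auto simp: theta_module_def)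
  moreover from this have "f - g = (P - P') * \<theta> + (Q - Q')" by (simp add: algebra_simps)
  ultimately show ?thesis unfolding theta_module_def using laurent_polynomial_diff by blast
qed

lemma theta_module_mult:
  assumes "laurent_polynomial h" "f \<in> theta_module"
  shows "h * f \<in> theta_module"
proof -
  obtain P Q where "f = P * \<theta> + Q" "laurent_polynomial P" "laurent_polynomial Q"
    using assms by (auto simp: theta_module_def)
  moreover from this have "h * f = (h * P) * \<theta> + h * Q" by (simp add: algebra_simps)
  ultimately show ?thesis unfolding theta_module_def using laurent_polynomial_mult assms(1) by blast
qed

lemma laurent_in_theta_module: "laurent_polynomial Q \<Longrightarrow> Q \<in> theta_module"
  unfolding theta_module_def by (rule CollectI, rule exI[of _ 0], rule exI[of _ Q]) simp

text \<open>Two representations give \<open>(P' - P) * \<theta> = Q - Q'\<close>, a Laurent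
  polynomial, which \<open>laurent_mult_theta_imp_zero\<close> permits only for
  \<open>P' = P\<close>.\<close>

lemma theta_module_unique:
  assumes "f \<in> theta_module"
  shows "\<exists>!PQ. case PQ of (P, Q) \<Rightarrow> laurent_polynomial P \<and> laurent_polynomial Q \<and> f = P * \<theta> + Q"
proof -
  obtain P Q where PQ: "f = P * \<theta> + Q" "laurent_polynomial P" "laurent_polynomial Q"
    using assms by (auto simp: theta_module_def)
  have "P' = P \<and> Q' = Q"
    if "laurent_polynomial P'" "laurent_polynomial Q'" "f = P' * \<theta> + Q'" for P' Q'
  proof -
    have "(P' - P) * \<theta> = Q - Q'" using that PQ by (simp add: algebra_simps)
    then have "P' - P = 0"
      using that PQ by (intro laurent_mult_theta_imp_zero) (simp_all add: laurent_polynomial_diff)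
    then show ?thesis using that PQ by simp
  qed
  then show ?thesis using PQ by (intro ex1I[of _ "(P, Q)"]) auto
qed

text \<open>The series \<open>\<Sum>\<^sub>l (-1)\<^sup>l q\<^bsup>x l + l (l + 1) / 2\<^esup>\<close> is \<open>\<theta>\<close> with its index shifted by \<open>x\<close>, up to a monomial and finitely many terms.\<close>

definition shifted_theta_sum :: "int \<Rightarrow> nat \<Rightarrow> complex fls" where
  "shifted_theta_sum x B = (\<Sum>l\<le>B. (-1) ^ l * qpow (x * int l + int (tri l)))"

text \<open>Split off \<open>l = 0\<close> and shift the index, using
  \<open>x (l + 1) + tri (l + 1) = (x + 1) + (x + 1) l + tri l\<close>. This links neighbouring
  values of \<open>x\<close>.\<close>

lemma shifted_theta_sum_Suc:
  "shifted_theta_sum x (Suc B) = 1 - qpow (x + 1) * shifted_theta_sum (x + 1) B"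
proof -
  have "(-1) ^ Suc l * qpow (x * int (Suc l) + int (tri (Suc l))) =
      - (qpow (x + 1) * ((-1) ^ l * qpow ((x + 1) * int l + int (tri l))))" for l
  proof -
    have "x * int (Suc l) + int (tri (Suc l)) = (x + 1) + ((x + 1) * int l + int (tri l))"
      by (simp add: tri_Suc algebra_simps)
    then show ?thesis by (simp only: qpow_add) (simp add: algebra_simps)
  qed
  then show ?thesis
    unfolding shifted_theta_sum_def sum.atMost_Suc_shift
    by (simp add: sum_negf sum_distrib_left del: power_Suc)
qed

lemma shifted_theta_sum_0: "vanishes_below (int B) (shifted_theta_sum 0 B - \<theta>)"
  unfolding vanishes_below_def
proof (intro allI impI)
  fix d assume d: "d < int B"
  have nth: "((-1) ^ l * qpow (int (tri l))) $$ d = (if int (tri l) = d then (-1) ^ l else 0)" for l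
    by (cases "even l") (auto simp: qpow_nth)
  show "(shifted_theta_sum 0 B - \<theta>) $$ d = 0"
  proof (cases "d < 0")
    case True
    then have "int (tri l) \<noteq> d" for l by linarith
    then show ?thesis using True by (simp add: shifted_theta_sum_def fls_nth_sum nth)
  next
    case False
    then obtain e where e: "d = int e" by (metis int_eq_iff not_less)
    have "shifted_theta_sum 0 B $$ d = (\<Sum>l\<le>B. if tri l = e then (-1) ^ l else 0)"
      by (simp add: shifted_theta_sum_def fls_nth_sum nth) (simp add: e)
    also have "\<dots> = (\<Sum>l\<le>e. if tri l = e then (-1) ^ l else 0)"
      using d e tri_ge by (intro sum.mono_neutral_right) (auto simp: not_le dest: leD)
    finally show ?thesis using e by (simp add: partial_theta_nth)
  qed
qed

text \<open>Induction in both directions from \<open>x = 0\<close>, where the limit is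
  \<open>\<theta>\<close>: the recurrence is solved for the sum at \<open>x + 1\<close>, or applied
  at \<open>x - 1\<close>. The limit is described by truncation errors, so that only finite sums
  occur.\<close>

lemma shifted_theta_sum_limit:
  "\<exists>f\<in>theta_module. \<exists>C. \<forall>B. vanishes_below (int B - C) (shifted_theta_sum x B - f)"
proof (induction x rule: int_induct[where k = 0])
  case base
  show ?case
  proof (intro bexI exI allI)
    show "vanishes_below (int B - 0) (shifted_theta_sum 0 B - \<theta>)" for B
      using shifted_theta_sum_0 by simp
    show "\<theta> \<in> theta_module"
      unfolding theta_module_def by (rule CollectI, rule exI[of _ 1], rule exI[of _ 0]) simp
  qed
next
  case (step1 x)
  then obtain f C where f: "f \<in> theta_module"
    and C: "\<And>B. vanishes_below (int B - C) (shifted_theta_sum x B - f)" by blast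
  let ?g = "qpow (- (x + 1)) * (1 - f)"
  have "vanishes_below (int B - (x + C)) (shifted_theta_sum (x + 1) B - ?g)" for B
  proof -
    have "shifted_theta_sum (x + 1) B - ?g = - (qpow (- (x + 1)) * (shifted_theta_sum x (Suc B) - f))"
      by (simp only: shifted_theta_sum_Suc right_diff_distrib qpow_cancel) simp
    moreover have "- (x + 1) + (int (Suc B) - C) = int B - (x + C)" by simp
    ultimately show ?thesis
      using vanishes_below_uminus[OF vanishes_below_qpow_mult[OF C[of "Suc B"], of "- (x + 1)"]]
      by (simp only:)
  qed
  moreover have "?g \<in> theta_module"
    by (intro theta_module_mult theta_module_diff f laurent_in_theta_module[of 1]) simp_all
  ultimately show ?case by blast
next
  case (step2 x)
  then obtain f C where f: "f \<in> theta_module"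
    and C: "\<And>B. vanishes_below (int B - C) (shifted_theta_sum x B - f)" by blast
  let ?g = "1 - qpow x * f"
  have gm: "?g \<in> theta_module"
    by (intro theta_module_mult theta_module_diff f laurent_in_theta_module[of 1]) simp_all
  have suc: "vanishes_below (x + (int B - C)) (shifted_theta_sum (x - 1) (Suc B) - ?g)" for B
  proof -
    have "shifted_theta_sum (x - 1) (Suc B) - ?g = - (qpow x * (shifted_theta_sum x B - f))"
      using shifted_theta_sum_Suc[of "x - 1" B] by (simp add: algebra_simps)
    then show ?thesis using vanishes_below_uminus[OF vanishes_below_qpow_mult[OF C[of B], of x]] by simp
  qed
  \<comment> \<open>The recurrence only covers \<open>Suc B\<close>. At \<open>B = 0\<close> any
    lower bound \<open>c\<close> for the exponents serves and enters the constant, whose summand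
    \<open>1\<close> pays for the \<open>Suc\<close>.\<close>
  obtain c where c: "vanishes_below c (shifted_theta_sum (x - 1) 0 - ?g)"
    using fls_eq0_below_subdegree unfolding vanishes_below_def by blast
  have "vanishes_below (int B - (\<bar>C\<bar> + \<bar>x\<bar> + \<bar>c\<bar> + 1)) (shifted_theta_sum (x - 1) B - ?g)" for B
  proof (cases B)
    case 0
    show ?thesis unfolding 0 by (rule vanishes_below_mono[OF c]) simp
  next
    case (Suc B')
    show ?thesis unfolding Suc by (rule vanishes_below_mono[OF suc]) simp
  qed
  with gm show ?case by blast
qed

section \<open>Elementary symmetric functions of powers of \<open>q\<close>\<close>

definition esym :: "nat \<Rightarrow> int set \<Rightarrow> complex fls" where
  "esym k X = (\<Sum>W | W \<subseteq> X \<and> card W = k. qpow (\<Sum>W))"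

lemma esym_0: "finite X \<Longrightarrow> esym 0 X = 1"
proof -
  assume "finite X"
  then have "{W. W \<subseteq> X \<and> card W = 0} = {{}}" by (auto dest: finite_subset)
  then show ?thesis by (simp add: esym_def)
qed

lemma esym_eq_0: "finite X \<Longrightarrow> card X < k \<Longrightarrow> esym k X = 0"
proof -
  assume "finite X" "card X < k"
  then have "{W. W \<subseteq> X \<and> card W = k} = {}" by (auto dest: card_mono)
  then show ?thesis by (simp only: esym_def sum.empty)
qed

lemma esym_insert:
  assumes "finite X" "x \<notin> X"
  shows "esym (Suc k) (insert x X) = esym (Suc k) X + qpow x * esym k X"
proof -
  let ?A = "{W. W \<subseteq> X \<and> card W = Suc k}" and ?B = "{W. W \<subseteq> X \<and> card W = k}"
  have fin: "finite W" "x \<notin> W" if "W \<subseteq> X" for W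
    using that assms by (auto dest: finite_subset)
  have split: "{W. W \<subseteq> insert x X \<and> card W = Suc k} = ?A \<union> insert x ` ?B"
  proof (intro equalityI subsetI)
    fix W assume W: "W \<in> {W. W \<subseteq> insert x X \<and> card W = Suc k}"
    show "W \<in> ?A \<union> insert x ` ?B"
    proof (cases "x \<in> W")
      case True
      then have "W = insert x (W - {x})" "W - {x} \<in> ?B" using W by auto
      then show ?thesis by blast
    qed (use W in auto)
  qed (use fin in auto)
  have inj: "inj_on (insert x) ?B"
    by (rule inj_onI) (simp add: fin insert_ident)
  have "esym (Suc k) (insert x X) = (\<Sum>W\<in>?A. qpow (\<Sum>W)) + (\<Sum>W\<in>insert x ` ?B. qpow (\<Sum>W))"
    unfolding esym_def split using assms by (intro sum.union_disjoint) auto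
  also have "(\<Sum>W\<in>insert x ` ?B. qpow (\<Sum>W)) = (\<Sum>W\<in>?B. qpow x * qpow (\<Sum>W))"
    using fin by (auto simp: sum.reindex[OF inj] qpow_add intro!: sum.cong)
  finally show ?thesis by (simp add: esym_def sum_distrib_left)
qed

text \<open>After \<open>esym_insert\<close> the terms containing \<open>qpow a * qpow b\<close>
  cancel. This is the source of the partial fraction recursion.\<close>

lemma esym_two_term:
  assumes "finite X" "a \<notin> X" "b \<notin> X"
  shows "(qpow b - qpow a) * esym k X = qpow b * esym k (insert a X) - qpow a * esym k (insert b X)"
  using assms by (cases k) (simp_all add: esym_0 esym_insert algebra_simps)

text \<open>\<open>esym_insert\<close>, solved for the smaller set and iterated; in the generating
  function, \<open>1 / (1 + q^x z)\<close> is expanded. This reduces an interval with one site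
  removed to the full interval, where the q-binomial theorem applies.\<close>

lemma esym_remove:
  assumes "finite X" "x \<notin> X"
  shows "esym k X = (\<Sum>l\<le>k. (-1) ^ l * qpow (x * int l) * esym (k - l) (insert x X))"
proof (induction k)
  case 0
  then show ?case using assms by (simp add: esym_0)
next
  case (Suc k)
  have "esym (Suc k) X = esym (Suc k) (insert x X) - qpow x * esym k X"
    using assms by (simp add: esym_insert)
  also have "qpow x * esym k X =
      (\<Sum>l\<le>k. - ((-1) ^ Suc l * qpow (x * int (Suc l)) * esym (k - l) (insert x X)))"
    unfolding Suc sum_distrib_left
    by (intro sum.cong) (simp_all add: distrib_left qpow_add mult_ac)
  finally show ?case
    unfolding sum.atMost_Suc_shift by (simp add: sum_negf)
qed

section \<open>Pochhammer symbols \<open>(q; q)_n\<close> and the q-binomial theorem\<close>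

definition qfac :: "nat \<Rightarrow> complex fps" where
  "qfac n = (\<Prod>i<n. 1 - fps_X ^ Suc i)"

lemma qfac_0 [simp]: "qfac 0 = 1"
  and qfac_Suc: "qfac (Suc n) = qfac n * (1 - fps_X ^ Suc n)"
  by (simp_all add: qfac_def)

lemma qfac_nth_0 [simp]: "qfac n $ 0 = 1"
  by (induction n) (simp_all add: qfac_Suc)

lemma qfac_nth_stable: "d \<le> n \<Longrightarrow> qfac n $ d = qfac d $ d"
proof (induction n rule: dec_induct)
  case (step n)
  then show ?case
    by (simp add: qfac_Suc right_diff_distrib fps_X_power_mult_right_nth del: power_Suc)
qed simp

definition euler_phi :: "complex fps" where
  "euler_phi = prodinf (\<lambda>m. 1 - fps_X ^ Suc m)"

lemma euler_phi_nth: "euler_phi $ d = qfac d $ d"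
proof -
  let ?g = "Abs_fps (\<lambda>d. qfac d $ d)"
  have "(\<lambda>n. \<Prod>i\<le>n. 1 - fps_X ^ Suc i) \<longlonglongrightarrow> ?g"
  proof (rule tendsto_fpsI)
    fix d
    have "(\<Prod>i\<le>n. 1 - fps_X ^ Suc i :: complex fps) $ d = ?g $ d" if "n \<ge> d" for n
      using qfac_nth_stable[of d "Suc n"] that by (simp add: qfac_def lessThan_Suc_atMost)
    then show "\<forall>\<^sub>F n in sequentially. (\<Prod>i\<le>n. 1 - fps_X ^ Suc i :: complex fps) $ d = ?g $ d"
      unfolding eventually_sequentially by blast
  qed
  \<comment> \<open>\<open>raw_has_prod\<close> requires a nonzero limit.\<close>
  moreover have "?g \<noteq> 0" by (auto simp: fps_eq_iff intro!: exI[of _ 0])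
  ultimately have "(\<lambda>m. 1 - fps_X ^ Suc m) has_prod ?g"
    by (simp add: has_prod_def raw_has_prod_def)
  then show ?thesis by (simp add: euler_phi_def has_prod_unique[symmetric])
qed

abbreviation \<phi> :: "complex fls" where
  "\<phi> \<equiv> fps_to_fls euler_phi"

lemma phi_qfac: "vanishes_below (int n + 1) (\<phi> - fps_to_fls (qfac n))"
  and qfac_qfac: "n \<le> n' \<Longrightarrow> vanishes_below (int n + 1) (fps_to_fls (qfac n') - fps_to_fls (qfac n))"
proof -
  have "qfac m $ nat d = qfac (nat d) $ nat d" if "n \<le> m" "d < int n + 1" for m d
    by (rule qfac_nth_stable) (use that in linarith)
  then show "vanishes_below (int n + 1) (\<phi> - fps_to_fls (qfac n))"
    and "n \<le> n' \<Longrightarrow> vanishes_below (int n + 1) (fps_to_fls (qfac n') - fps_to_fls (qfac n))"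
    by (auto simp: vanishes_below_def euler_phi_nth)
qed

text \<open>The exponent is \<open>a k + k (k - 1) / 2\<close>.\<close>

lemma esym_interval:
  "k \<le> n \<Longrightarrow> esym k {a..<a + int n} * fps_to_fls (qfac k) * fps_to_fls (qfac (n - k))
     = qpow ((a - 1) * int k + int (tri k)) * fps_to_fls (qfac n)"
proof (induction n arbitrary: k)
  case 0
  then show ?case by (simp add: esym_0)
next
  case (Suc n)
  have qf: "fps_to_fls (qfac (Suc m)) = fps_to_fls (qfac m) * (1 - qpow (int (Suc m)))" for m
    by (simp add: qfac_Suc fls_times_fps_to_fls fps_to_fls_X_power del: power_Suc)
  have iv: "{a..<a + int (Suc n)} = insert (a + int n) {a..<a + int n}" by auto
  show ?case
  proof (cases k)
    case 0
    then show ?thesis by (simp add: esym_0)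
  next
    case (Suc j)
    then have j: "j \<le> n" using Suc.prems by simp
    let ?E = "(a - 1) * int j + int (tri j)"
    have e: "(a - 1) * int (Suc j) + int (tri (Suc j)) = ?E + a + int j"
      by (simp add: tri_Suc algebra_simps)
    \<comment> \<open>\<open>E1\<close> and \<open>E2\<close> treat the subsets without and with the
      new largest element \<open>a + int n\<close>.\<close>
    have E1: "esym (Suc j) {a..<a + int n} * fps_to_fls (qfac (Suc j)) * fps_to_fls (qfac (n - j))
       = (1 - qpow (int n - int j)) * (qpow (?E + a + int j) * fps_to_fls (qfac n))"
    \<comment> \<open>For \<open>j = n\<close> the induction hypothesis does not reach
      \<open>Suc j\<close>. Both sides vanish: the interval has only \<open>n\<close> elements, and
      \<open>1 - qpow 0 = 0\<close>.\<close>
    proof (cases "j = n")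
      case True
      then show ?thesis by (simp add: esym_eq_0)
    next
      case False
      then have "n - j = Suc (n - Suc j)" "int (Suc (n - Suc j)) = int n - int j" using j by auto
      then show ?thesis using Suc.IH[of "Suc j"] False j unfolding e
        by (simp add: qf mult_ac)
    qed
    have E2: "qpow (a + int n) * esym j {a..<a + int n} * fps_to_fls (qfac (Suc j)) * fps_to_fls (qfac (n - j))
       = (1 - qpow (int j + 1)) * qpow (int n - int j) * (qpow (?E + a + int j) * fps_to_fls (qfac n))"
    proof -
      have "qpow (a + int n) * esym j {a..<a + int n} * fps_to_fls (qfac (Suc j)) * fps_to_fls (qfac (n - j))
        = qpow (a + int n) * (1 - qpow (int j + 1)) *
            (esym j {a..<a + int n} * fps_to_fls (qfac j) * fps_to_fls (qfac (n - j)))"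
        by (simp add: qf mult_ac add.commute)
      also have "\<dots> = (1 - qpow (int j + 1)) * (qpow (a + int n) * qpow ?E) * fps_to_fls (qfac n)"
        unfolding Suc.IH[OF j] by (simp only: mult_ac)
      also have "qpow (a + int n) * qpow ?E = qpow (int n - int j) * qpow (?E + a + int j)"
        by (simp flip: qpow_add add: algebra_simps)
      finally show ?thesis by (simp only: mult_ac)
    qed
    have "qpow (int n - int j) * qpow (int j + 1) = qpow (int (Suc n))"
      by (simp flip: qpow_add add: algebra_simps)
    \<comment> \<open>The q-Pascal rule, cleared of denominators.\<close>
    then have sum: "(1 - qpow (int n - int j)) + (1 - qpow (int j + 1)) * qpow (int n - int j) = 1 - qpow (int (Suc n))"
      by (simp add: algebra_simps)
    have "esym k {a..<a + int (Suc n)} * fps_to_fls (qfac k) * fps_to_fls (qfac (Suc n - k)) =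
      esym (Suc j) {a..<a + int n} * fps_to_fls (qfac (Suc j)) * fps_to_fls (qfac (n - j)) +
      qpow (a + int n) * esym j {a..<a + int n} * fps_to_fls (qfac (Suc j)) * fps_to_fls (qfac (n - j))"
      unfolding iv Suc by (simp add: esym_insert distrib_right del: of_nat_Suc)
    also have "\<dots> = (1 - qpow (int (Suc n))) * (qpow (?E + a + int j) * fps_to_fls (qfac n))"
      unfolding E1 E2 sum[symmetric] by (simp only: distrib_right)
    finally show ?thesis unfolding Suc e qf by (simp only: mult_ac)
  qed
qed

lemma vanishes_below_iff: "vanishes_below n f \<longleftrightarrow> f = 0 \<or> n \<le> fls_subdegree f"
  unfolding vanishes_below_def
  using fls_eq0_below_subdegree[of _ f] fls_subdegree_geI[of f n] by fastforce

text \<open>A power series with nonzero constant term has subdegree 0, so multiplying by it keeps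
  the order of vanishing. This replaces division by Pochhammer symbols.\<close>

lemma vanishes_below_cancel:
  assumes "vanishes_below n (f * fps_to_fls u)" "u $ 0 \<noteq> 0"
  shows "vanishes_below n f"
proof -
  have "u \<noteq> 0" "fls_subdegree (fps_to_fls u) = 0"
    using assms(2) by (auto simp: fls_subdegree_fls_to_fps)
  then show ?thesis using assms(1) by (cases "f = 0") (auto simp: vanishes_below_iff)
qed

lemma tri_int: "2 * int (tri l) = int l * (int l + 1)"
  by (induction l) (simp_all add: tri_Suc algebra_simps)

text \<open>By \<open>esym_interval\<close> the factor next to \<open>\<phi>\<close> equals
  \<open>q^(tri l) (q; q)_(2B) / ((q; q)_(B-l) (q; q)_(B+l))\<close>. All these Pochhammer symbols
  agree with \<open>\<phi>\<close> up to order \<open>B - l\<close>, so after multiplication by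
  \<open>\<phi>\<close> only \<open>q^(tri l)\<close> remains to that relative order.\<close>

lemma phi_esym_interval:
  assumes "l \<le> B"
  shows "vanishes_below (int (tri l) + int B - int l)
    (\<phi> * (qpow (int (tri B)) * esym (B - l) {- int B..<int B}) - qpow (int (tri l)))"
proof -
  let ?j = "B - l" and ?e = "(- int B - 1) * int (B - l) + int (tri (B - l))"
  let ?f = "\<lambda>n. fps_to_fls (qfac n)"
  \<comment> \<open>Doubling turns triangular numbers into products, so that polynomial arithmetic
    suffices.\<close>
  have "2 * (int (tri B) + ?e) = 2 * int (tri l)"
    unfolding distrib_left tri_int using assms by (simp add: algebra_simps of_nat_diff)
  then have exp: "int (tri B) + ?e = int (tri l)" by simp
  have "- int B + int (2 * B) = int B" by simp
  with esym_interval[of ?j "2 * B" "- int B"]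
  have g: "esym ?j {- int B..<int B} * ?f ?j * ?f (2 * B - ?j) = qpow ?e * ?f (2 * B)" by simp
  define h where "h = \<phi> * (qpow (int (tri B)) * esym ?j {- int B..<int B}) - qpow (int (tri l))"
  have "h * fps_to_fls (qfac ?j * qfac (2 * B - ?j)) =
      \<phi> * (qpow (int (tri B)) * (esym ?j {- int B..<int B} * ?f ?j * ?f (2 * B - ?j)))
        - qpow (int (tri l)) * (?f ?j * ?f (2 * B - ?j))"
    by (simp add: h_def algebra_simps fls_times_fps_to_fls)
  also have "qpow (int (tri B)) * (esym ?j {- int B..<int B} * ?f ?j * ?f (2 * B - ?j)) =
     qpow (int (tri l)) * ?f (2 * B)"
    unfolding g exp[symmetric] by (simp add: qpow_add)
  \<comment> \<open>The difference telescopes through \<open>?f ?j * ?f (2 * B)\<close>. Both errors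
    have order above \<open>?j\<close>, the second because
    \<open>?j \<le> 2 * B - ?j\<close>.\<close>
  also have "\<phi> * (qpow (int (tri l)) * ?f (2 * B)) - qpow (int (tri l)) * (?f ?j * ?f (2 * B - ?j)) =
     qpow (int (tri l)) * ((\<phi> - ?f ?j) * ?f (2 * B) + ?f ?j * (?f (2 * B) - ?f (2 * B - ?j)))"
    by (simp add: algebra_simps)
  finally have eq: "h * fps_to_fls (qfac ?j * qfac (2 * B - ?j)) = \<dots>" .
  have "vanishes_below (int ?j + 1 + 0) ((\<phi> - ?f ?j) * ?f (2 * B))"
    by (intro vanishes_below_mult phi_qfac vanishes_below_fps)
  moreover have "vanishes_below (0 + (int (2 * B - ?j) + 1)) (?f ?j * (?f (2 * B) - ?f (2 * B - ?j)))"
    by (intro vanishes_below_mult qfac_qfac vanishes_below_fps) simp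
  then have "vanishes_below (int ?j + 1 + 0) (?f ?j * (?f (2 * B) - ?f (2 * B - ?j)))"
    by (rule vanishes_below_mono) simp
  ultimately have "vanishes_below (int (tri l) + (int ?j + 1 + 0)) (h * fps_to_fls (qfac ?j * qfac (2 * B - ?j)))"
    unfolding eq by (intro vanishes_below_qpow_mult vanishes_below_add)
  then have "vanishes_below (int (tri l) + (int ?j + 1 + 0)) h"
    by (rule vanishes_below_cancel) simp
  then show ?thesis unfolding h_def by (rule vanishes_below_mono) (use assms in simp)
qed

text \<open>The trace over charge 0 diagrams that agree with the vacuum outside the window
  \<open>{- int B..<int B}\<close>; these have exactly \<open>B\<close> occupied sites there. The
  vacuum occupies \<open>{- int B..<0}\<close>, of sum \<open>- tri B\<close>, and the prefactor
  gives it energy 0.\<close>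

definition truncated_trace :: "nat \<Rightarrow> int set \<Rightarrow> complex fls" where
  "truncated_trace B I = qpow (int (tri B)) * esym B ({- int B..<int B} - I)"

text \<open>\<open>esym_remove\<close> produces the terms of the shifted theta sum one by one, each
  with the error of \<open>phi_esym_interval\<close>.\<close>

lemma truncated_trace_singleton:
  "vanishes_below (int B - (2 * x - 1)\<^sup>2) (\<phi> * truncated_trace B {x} - shifted_theta_sum x B)"
  if x: "x \<in> {- int B..<int B}"
proof -
  let ?X = "{- int B..<int B} - {x}"
  have ins: "insert x ?X = {- int B..<int B}" using x by auto
  have "truncated_trace B {x} =
      (\<Sum>l\<le>B. (-1) ^ l * qpow (x * int l) * (qpow (int (tri B)) * esym (B - l) {- int B..<int B}))"
    unfolding truncated_trace_def using esym_remove[of ?X x B]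
    by (simp only: ins) (simp add: sum_distrib_left mult_ac)
  then have "\<phi> * truncated_trace B {x} - shifted_theta_sum x B =
      (\<Sum>l\<le>B. (-1) ^ l * (qpow (x * int l) *
        (\<phi> * (qpow (int (tri B)) * esym (B - l) {- int B..<int B}) - qpow (int (tri l)))))"
    unfolding shifted_theta_sum_def
    by (simp add: sum_distrib_left qpow_add algebra_simps flip: sum_subtractf)
  also have "vanishes_below (int B - (2 * x - 1)\<^sup>2) \<dots>"
  proof (rule vanishes_below_sum)
    fix l assume "l \<in> {..B}"
    then have l: "l \<le> B" by simp
    let ?h = "qpow (x * int l) * (\<phi> * (qpow (int (tri B)) * esym (B - l) {- int B..<int B}) - qpow (int (tri l)))"
    have "vanishes_below (x * int l + (int (tri l) + int B - int l)) ?h"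
      by (intro vanishes_below_qpow_mult phi_esym_interval l)
    moreover have "int B - (2 * x - 1)\<^sup>2 \<le> x * int l + (int (tri l) + int B - int l)"
    proof -
      \<comment> \<open>Completing the square in \<open>l\<close> bounds the error exponent from
        below uniformly in \<open>l\<close>.\<close>
      have "0 \<le> (int l + (2 * x - 1))\<^sup>2 + int l * int l + 3 * (2 * x - 1)\<^sup>2" by simp
      also have "\<dots> = 2 * (2 * (x * int l + int (tri l) - int l)) + 4 * (2 * x - 1)\<^sup>2"
        using tri_int[of l] by (simp add: power2_eq_square algebra_simps)
      finally show ?thesis by simp
    qed
    ultimately have "vanishes_below (int B - (2 * x - 1)\<^sup>2) ?h" by (rule vanishes_below_mono)
    then show "vanishes_below (int B - (2 * x - 1)\<^sup>2) ((-1) ^ l * ?h)"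
      by (cases "even l") (auto intro: vanishes_below_uminus)
  qed
  finally show ?thesis .
qed

section \<open>Maya diagrams\<close>

text \<open>Condition \<open>x \<ge> 0\<close> forbids \<open>\<psi>(-x-1/2)\<close> and condition \<open>x < 0\<close> demands \<open>\<psi>\<^sup>*(x+1/2)\<close>: in either case
  site \<open>x\<close> of the Maya diagram is empty.\<close>

definition vacant :: "int \<Rightarrow> nat set \<Rightarrow> nat set \<Rightarrow> bool" where
  "vacant x N M \<longleftrightarrow> (if x \<ge> 0 then nat x \<notin> N else nat (- x - 1) \<in> M)"

definition vacancy_series :: "int set \<Rightarrow> complex fps" where
  "vacancy_series I =
     Abs_fps (\<lambda>d. of_nat (card {(N, M) \<in> charge0_states d. \<forall>x\<in>I. vacant x N M}))"

text \<open>The Dirac sea is cut off at \<open>- int B\<close>, so that a diagram becomes a finite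
  set: the negative sites of the window are occupied except for the holes given by
  \<open>M\<close>.\<close>

definition maya :: "nat \<Rightarrow> nat set \<times> nat set \<Rightarrow> int set" where
  "maya B = (\<lambda>(N, M). int ` N \<union> (\<lambda>m. - int m - 1) ` ({..<B} - M))"

lemma nonneg_in_maya: "x \<ge> 0 \<Longrightarrow> x \<in> maya B (N, M) \<longleftrightarrow> nat x \<in> N"
  by (auto simp: maya_def image_iff) (metis int_nat_eq)

lemma neg_in_maya: "x < 0 \<Longrightarrow> - int B \<le> x \<Longrightarrow> x \<in> maya B (N, M) \<longleftrightarrow> nat (- x - 1) \<notin> M"
  by (auto simp: maya_def image_iff intro!: bexI[of _ "nat (- x - 1)"])

lemma bij_betw_maya: "bij_betw (maya B) (Pow {..<B} \<times> Pow {..<B}) (Pow {- int B..<int B})"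
proof (rule bij_betw_byWitness[where f' = "\<lambda>W. ({n. int n \<in> W}, {m. m < B \<and> - int m - 1 \<notin> W})"])
  show "\<forall>a\<in>Pow {..<B} \<times> Pow {..<B}.
      ({n. int n \<in> maya B a}, {m. m < B \<and> - int m - 1 \<notin> maya B a}) = a"
    by (auto simp: nonneg_in_maya neg_in_maya)
  show "\<forall>W\<in>Pow {- int B..<int B}. maya B ({n. int n \<in> W}, {m. m < B \<and> - int m - 1 \<notin> W}) = W"
  proof (intro ballI set_eqI)
    fix W x assume W: "W \<in> Pow {- int B..<int B}"
    let ?M = "maya B ({n. int n \<in> W}, {m. m < B \<and> - int m - 1 \<notin> W})"
    show "x \<in> ?M \<longleftrightarrow> x \<in> W"
    proof (cases "- int B \<le> x")
      case True
      then show ?thesis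
        by (cases "x \<ge> 0") (auto simp: nonneg_in_maya neg_in_maya)
    next
      case False
      then show ?thesis using W by (auto simp: maya_def)
    qed
  qed
qed (auto simp: maya_def)

text \<open>Charge 0 thus turns into the degree \<open>B\<close> of the symmetric function.\<close>

lemma card_maya:
  assumes "N \<subseteq> {..<B}" "M \<subseteq> {..<B}"
  shows "card (maya B (N, M)) = B \<longleftrightarrow> card N = card M"
proof -
  have fin: "finite N" "finite M" using assms finite_subset by blast+
  have "card M \<le> B" using assms card_mono[of "{..<B}" M] by simp
  moreover have "card (maya B (N, M)) = card N + (B - card M)"
    unfolding maya_def prod.case using fin assms
    by (subst card_Un_disjoint) (auto simp: card_image inj_on_def card_Diff_subset)
  ultimately show ?thesis by auto
qed

lemma tri_sum: "tri B = (\<Sum>m<B. m + 1)"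
  by (induction B) (simp_all add: tri_Suc)

text \<open>The right-hand side is the energy when \<open>card N = card M\<close>, because the
  halves then add up to \<open>card M\<close>.\<close>

lemma sum_maya:
  assumes "N \<subseteq> {..<B}" "M \<subseteq> {..<B}"
  shows "int (tri B) + \<Sum>(maya B (N, M)) = int (\<Sum>N + \<Sum>M + card M)"
proof -
  have fin: "finite N" "finite M" using assms finite_subset by blast+
  have "\<Sum>(maya B (N, M)) = \<Sum>(int ` N) + \<Sum>((\<lambda>m. - int m - 1) ` ({..<B} - M))"
    unfolding maya_def prod.case using fin by (intro sum.union_disjoint) auto
  also have "\<dots> = int (\<Sum>N) - (\<Sum>m\<in>{..<B} - M. int (m + 1))"
    by (simp add: sum.reindex inj_on_def sum_subtractf sum_negf sum.distrib)
  also have "(\<Sum>m\<in>{..<B} - M. int (m + 1)) = int (tri B) - int (\<Sum>m\<in>M. m + 1)"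
    using assms(2) by (simp add: sum_diff fin tri_sum)
  finally show ?thesis by (simp add: sum.distrib)
qed

lemma vacant_iff_maya:
  "x \<in> {- int B..<int B} \<Longrightarrow> vacant x N M \<longleftrightarrow> x \<notin> maya B (N, M)"
  by (cases "x \<ge> 0") (auto simp: vacant_def nonneg_in_maya neg_in_maya)

lemma truncated_trace_states:
  assumes "I \<subseteq> {- int B..<int B}"
  shows "truncated_trace B I = (\<Sum>(N, M) | N \<subseteq> {..<B} \<and> M \<subseteq> {..<B} \<and> card N = card M \<and>
    (\<forall>x\<in>I. vacant x N M). qpow (int (\<Sum>N + \<Sum>M + card M)))"
proof -
  let ?S = "{(N, M). N \<subseteq> {..<B} \<and> M \<subseteq> {..<B} \<and> card N = card M \<and> (\<forall>x\<in>I. vacant x N M)}"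
  let ?T = "{W. W \<subseteq> {- int B..<int B} - I \<and> card W = B}"
  have "?S = {a \<in> Pow {..<B} \<times> Pow {..<B}. maya B a \<in> ?T}"
  proof (rule set_eqI, clarify)
    fix N M
    show "(N, M) \<in> ?S \<longleftrightarrow> (N, M) \<in> {a \<in> Pow {..<B} \<times> Pow {..<B}. maya B a \<in> ?T}"
    proof (cases "N \<subseteq> {..<B} \<and> M \<subseteq> {..<B}")
      case True
      then have "maya B (N, M) \<subseteq> {- int B..<int B}"
        using bij_betwE[OF bij_betw_maya] by blast
      moreover have "(\<forall>x\<in>I. vacant x N M) \<longleftrightarrow> (\<forall>x\<in>I. x \<notin> maya B (N, M))"
        using assms by (intro ball_cong vacant_iff_maya) auto
      ultimately show ?thesis using True card_maya[of N B M] by auto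
    qed auto
  qed
  moreover have "bij_betw (maya B) {a \<in> Pow {..<B} \<times> Pow {..<B}. maya B a \<in> ?T} ?T"
  proof (rule bij_betw_subset[OF bij_betw_maya])
    have "maya B ` {a \<in> Pow {..<B} \<times> Pow {..<B}. maya B a \<in> ?T} =
        maya B ` (Pow {..<B} \<times> Pow {..<B}) \<inter> ?T" by blast
    also have "\<dots> = ?T" unfolding bij_betw_imp_surj_on[OF bij_betw_maya] by blast
    finally show "maya B ` {a \<in> Pow {..<B} \<times> Pow {..<B}. maya B a \<in> ?T} = ?T" .
  qed blast
  ultimately have bij: "bij_betw (maya B) ?S ?T" by simp
  have "truncated_trace B I = (\<Sum>W\<in>?T. qpow (int (tri B) + \<Sum>W))"
    by (simp add: truncated_trace_def esym_def sum_distrib_left qpow_add)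
  also have "\<dots> = (\<Sum>a\<in>?S. qpow (int (tri B) + \<Sum>(maya B a)))"
    by (rule sum.reindex_bij_betw[OF bij, symmetric])
  also have "\<dots> = (\<Sum>(N, M)\<in>?S. qpow (int (\<Sum>N + \<Sum>M + card M)))"
    by (intro sum.cong) (auto simp only: sum_maya split: prod.splits)
  finally show ?thesis .
qed

lemma charge0_states_eq:
  "charge0_states d = {(N, M). finite N \<and> finite M \<and> card N = card M \<and> \<Sum>N + \<Sum>M + card M = d}"
proof -
  have "energy N M = of_nat d \<longleftrightarrow> \<Sum>N + \<Sum>M + card M = d" if "card N = card M" for N M
  proof -
    have "energy N M = of_nat (\<Sum>N + \<Sum>M + card M)"
      using that by (simp add: energy_def sum.distrib)
    then show ?thesis by (simp only: of_nat_eq_iff)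
  qed
  then have "charge N M = 0 \<and> energy N M = of_nat d \<longleftrightarrow> card N = card M \<and> \<Sum>N + \<Sum>M + card M = d" for N M
    by (auto simp: charge_def)
  then show ?thesis by (auto simp: charge0_states_def)
qed

text \<open>A charge 0 state of energy below \<open>B\<close> has all its modes below
  \<open>B\<close>, so the window already contains every state that contributes.\<close>

lemma vacancy_series_truncated:
  assumes "I \<subseteq> {- int B..<int B}"
  shows "vanishes_below (int B) (fps_to_fls (vacancy_series I) - truncated_trace B I)"
  unfolding vanishes_below_def
proof (intro allI impI)
  fix d assume d: "d < int B"
  let ?S = "{(N, M). N \<subseteq> {..<B} \<and> M \<subseteq> {..<B} \<and> card N = card M \<and> (\<forall>x\<in>I. vacant x N M)}"
  have fin: "finite ?S" by (rule finite_subset[of _ "Pow {..<B} \<times> Pow {..<B}"]) auto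
  have t: "truncated_trace B I $$ d = (\<Sum>(N, M)\<in>?S. if d = int (\<Sum>N + \<Sum>M + card M) then 1 else 0)"
    unfolding truncated_trace_states[OF assms] fls_nth_sum
    by (intro sum.cong) (auto simp: qpow_nth)
  show "(fps_to_fls (vacancy_series I) - truncated_trace B I) $$ d = 0"
  proof (cases "d < 0")
    case True
    then have "truncated_trace B I $$ d = 0"
      unfolding t by (intro sum.neutral) (auto simp del: of_nat_add of_nat_sum)
    then show ?thesis using True by simp
  next
    case False
    then obtain e where e: "d = int e" by (metis int_eq_iff not_less)
    have "{a \<in> ?S. case a of (N, M) \<Rightarrow> \<Sum>N + \<Sum>M + card M = e} =
        {(N, M) \<in> charge0_states e. \<forall>x\<in>I. vacant x N M}"
    proof -
      have sub: "N \<subseteq> {..<B}" if "finite N" "\<Sum>N \<le> e" for N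
      proof
        fix n assume "n \<in> N"
        then have "n \<le> \<Sum>N" using member_le_sum[of n N "\<lambda>x. x"] that(1) by simp
        then show "n \<in> {..<B}" using that d e by simp
      qed
      have "N \<subseteq> {..<B} \<and> M \<subseteq> {..<B}"
        if "finite N" "finite M" "\<Sum>N + \<Sum>M + card M = e" for N M
        using sub[OF that(1)] sub[OF that(2)] that(3) by linarith
      then show ?thesis unfolding charge0_states_eq by (blast dest: finite_subset[OF _ finite_lessThan])
    qed
    then have "of_nat (card {a \<in> ?S. case a of (N, M) \<Rightarrow> \<Sum>N + \<Sum>M + card M = e}) = vacancy_series I $ e"
      by (simp add: vacancy_series_def)
    moreover have "truncated_trace B I $$ d =
        (\<Sum>a\<in>?S. if (case a of (N, M) \<Rightarrow> \<Sum>N + \<Sum>M + card M = e) then 1 else 0)"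
      unfolding t by (intro sum.cong) (auto simp: e simp del: of_nat_add of_nat_sum)
    ultimately show ?thesis using fin e by (simp add: sum.If_cases Int_def)
  qed
qed

section \<open>The partial fraction recursion\<close>

abbreviation vacancy :: "int set \<Rightarrow> complex fls" where
  "vacancy I \<equiv> fps_to_fls (vacancy_series I)"

lemma finite_int_set_bounded:
  assumes "finite (I :: int set)"
  obtains B0 :: nat where "\<And>B. B \<ge> B0 \<Longrightarrow> I \<subseteq> {- int B..<int B}"
proof -
  have "I \<subseteq> {- int B..<int B}" if "B \<ge> nat (\<Sum>x\<in>I. \<bar>x\<bar>) + 1" for B
  proof
    fix x assume "x \<in> I"
    then have "\<bar>x\<bar> \<le> (\<Sum>x\<in>I. \<bar>x\<bar>)" using assms by (intro member_le_sum) auto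
    then show "x \<in> {- int B..<int B}" using that by auto
  qed
  then show ?thesis using that by blast
qed

text \<open>For truncated traces this is \<open>esym_two_term\<close>, applied to the unconstrained
  sites of the window. The truncation errors lose at most
  \<open>\<bar>a\<bar> + \<bar>b\<bar>\<close> orders under the powers of \<open>q\<close>, and
  \<open>B\<close> is arbitrarily large.\<close>

lemma vacancy_two_term:
  assumes "finite I" "a \<notin> I" "b \<notin> I" "a \<noteq> b"
  shows "(qpow b - qpow a) * vacancy (insert a (insert b I)) =
    qpow b * vacancy (insert b I) - qpow a * vacancy (insert a I)"
proof -
  let ?J = "insert a (insert b I)"
  obtain B0 where B0: "\<And>B. B \<ge> B0 \<Longrightarrow> ?J \<subseteq> {- int B..<int B}"
    using finite_int_set_bounded[of ?J] assms(1) by auto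
  let ?r = "\<lambda>B K. vacancy K - truncated_trace B K"
  show ?thesis
  proof (rule eq_if_vanishes_below)
    fix B assume "B \<ge> B0"
    note J = B0[OF this]
    have "(qpow b - qpow a) * truncated_trace B ?J =
        qpow b * truncated_trace B (insert b I) - qpow a * truncated_trace B (insert a I)"
    proof -
      \<comment> \<open>Passing to complements exchanges \<open>a\<close> and \<open>b\<close>:
        freeing site \<open>a\<close> leaves \<open>b\<close> constrained.\<close>
      have "insert a ({- int B..<int B} - ?J) = {- int B..<int B} - insert b I"
        "insert b ({- int B..<int B} - ?J) = {- int B..<int B} - insert a I"
        using J assms by auto
      then show ?thesis
        using esym_two_term[of "{- int B..<int B} - ?J" a b B]
        by (simp add: truncated_trace_def right_diff_distrib mult.left_commute[of _ "qpow (int (tri B))"])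
    qed
    then have "(qpow b - qpow a) * vacancy ?J - (qpow b * vacancy (insert b I) - qpow a * vacancy (insert a I)) =
      qpow b * ?r B ?J - qpow a * ?r B ?J - (qpow b * ?r B (insert b I) - qpow a * ?r B (insert a I))"
      by (simp add: algebra_simps)
    also have "vanishes_below (int B - (\<bar>a\<bar> + \<bar>b\<bar>)) \<dots>"
    proof -
      have r: "vanishes_below (int B) (?r B K)" if "K \<subseteq> ?J" for K
        using that J by (intro vacancy_series_truncated) auto
      have h: "vanishes_below (int B - (\<bar>a\<bar> + \<bar>b\<bar>)) (qpow c * ?r B K)" if "K \<subseteq> ?J" "c \<in> {a, b}" for c K
        by (rule vanishes_below_mono[OF vanishes_below_qpow_mult[OF r[OF that(1)]]]) (use that in auto)
      show ?thesis by (intro vanishes_below_diff h) auto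
    qed
    finally show "vanishes_below (int B - (\<bar>a\<bar> + \<bar>b\<bar>)) ((qpow b - qpow a) * vacancy ?J -
        (qpow b * vacancy (insert b I) - qpow a * vacancy (insert a I)))" .
  qed
qed

text \<open>Three approximations are chained: the series by its truncated trace, this by the shifted
  theta sum, and the latter by its limit \<open>f\<close>.\<close>

lemma vacancy_singleton: "\<phi> * vacancy {x} \<in> theta_module"
proof -
  obtain f C where f: "f \<in> theta_module"
    and C: "\<And>B. vanishes_below (int B - C) (shifted_theta_sum x B - f)"
    using shifted_theta_sum_limit by blast
  obtain B0 where B0: "\<And>B. B \<ge> B0 \<Longrightarrow> {x} \<subseteq> {- int B..<int B}"
    using finite_int_set_bounded[of "{x}"] by auto
  have "\<phi> * vacancy {x} = f"
  proof (rule eq_if_vanishes_below)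
    fix B assume "B \<ge> B0"
    note x = B0[OF this]
    let ?c = "\<bar>C\<bar> + (2 * x - 1)\<^sup>2"
    have "\<phi> * vacancy {x} - f = \<phi> * (vacancy {x} - truncated_trace B {x})
        + (\<phi> * truncated_trace B {x} - shifted_theta_sum x B) + (shifted_theta_sum x B - f)"
      by (simp add: algebra_simps)
    also have "vanishes_below (int B - ?c) \<dots>"
    proof (intro vanishes_below_add)
      have "vanishes_below (0 + int B) (\<phi> * (vacancy {x} - truncated_trace B {x}))"
        by (intro vanishes_below_mult vanishes_below_fps vacancy_series_truncated x)
      then show "vanishes_below (int B - ?c) (\<phi> * (vacancy {x} - truncated_trace B {x}))"
        by (rule vanishes_below_mono) (use zero_le_power2[of "2 * x - 1"] in linarith)
      show "vanishes_below (int B - ?c) (\<phi> * truncated_trace B {x} - shifted_theta_sum x B)"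
        using x by (intro vanishes_below_mono[OF truncated_trace_singleton]) auto
      show "vanishes_below (int B - ?c) (shifted_theta_sum x B - f)"
        by (rule vanishes_below_mono[OF C]) (use zero_le_power2[of "2 * x - 1"] in linarith)
    qed
    finally show "vanishes_below (int B - ?c) (\<phi> * vacancy {x} - f)" .
  qed
  with f show ?thesis by simp
qed

definition pair_factor :: "int \<Rightarrow> int \<Rightarrow> complex fls" where
  "pair_factor x y = 1 - qpow \<bar>x - y\<bar>"

definition pair_product :: "(nat \<Rightarrow> int) \<Rightarrow> nat set \<Rightarrow> complex fls" where
  "pair_product y J = (\<Prod>(k, l) | k \<in> J \<and> l \<in> J \<and> k < l. pair_factor (y k) (y l))"

lemma pair_factor_commute: "pair_factor x y = pair_factor y x"
  by (simp add: pair_factor_def abs_minus_commute)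

text \<open>The factor differs from the coefficient in \<open>vacancy_two_term\<close> only by a
  signed monomial, so it can clear that denominator.\<close>

lemma pair_factor_unit:
  "\<exists>u. laurent_polynomial u \<and> pair_factor a b = u * (qpow b - qpow a)"
proof (cases "a \<le> b")
  case True
  then have "pair_factor a b = - qpow (- a) * (qpow b - qpow a)"
    by (simp add: pair_factor_def algebra_simps flip: qpow_add)
  then show ?thesis by (intro exI[of _ "- qpow (- a)"]) (simp add: laurent_polynomial_uminus)
next
  case False
  then have "pair_factor a b = qpow (- b) * (qpow b - qpow a)"
    by (simp add: pair_factor_def algebra_simps flip: qpow_add)
  then show ?thesis by (intro exI[of _ "qpow (- b)"]) simp
qed

lemma laurent_pair_factors: "laurent_polynomial (\<Prod>i\<in>K. pair_factor x (y i))"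
  by (intro laurent_polynomial_prod) (simp add: pair_factor_def laurent_polynomial_diff)

lemma pair_product_insert:
  assumes "finite J" "a \<notin> J"
  shows "pair_product y (insert a J) = pair_product y J * (\<Prod>i\<in>J. pair_factor (y a) (y i))"
proof -
  let ?P = "\<lambda>J. {(k, l). k \<in> J \<and> l \<in> J \<and> k < l}"
  let ?h = "\<lambda>i. if i < a then (i, a) else (a, i)"
  have fin: "finite (?P J)" by (rule finite_subset[of _ "J \<times> J"]) (use assms in auto)
  have "?P (insert a J) = ?P J \<union> ?h ` J" using assms(2)
    by (auto simp: image_iff) (metis linorder_neqE_nat)
  then have "pair_product y (insert a J) =
      pair_product y J * (\<Prod>(k, l)\<in>?h ` J. pair_factor (y k) (y l))"
    unfolding pair_product_def using fin assms
    by (simp only:) (intro prod.union_disjoint; auto)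
  moreover have "inj_on ?h J" by (auto simp: inj_on_def split: if_splits)
  then have "(\<Prod>(k, l)\<in>?h ` J. pair_factor (y k) (y l)) = (\<Prod>i\<in>J. pair_factor (y a) (y i))"
    by (subst prod.reindex) (auto simp: pair_factor_commute intro!: prod.cong)
  ultimately show ?thesis by simp
qed

text \<open>Induction on the number of sites. The factor of one pair \<open>a\<close>,
  \<open>b\<close> clears the denominator of \<open>vacancy_two_term\<close>, which leaves two
  traces with one site fewer; a single site is \<open>vacancy_singleton\<close>.\<close>

lemma pair_product_vacancy:
  assumes "finite J" "J \<noteq> {}" "inj_on y J"
  shows "pair_product y J * \<phi> * vacancy (y ` J) \<in> theta_module"
  using assms
proof (induction "card J" arbitrary: J rule: less_induct)
  case less
  obtain a where a: "a \<in> J" using less.prems by blast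
  show ?case
  proof (cases "J = {a}")
    case True
    have "{(k, l). k \<in> {a} \<and> l \<in> {a} \<and> k < l} = {}" by auto
    then have "pair_product y {a} = 1" by (simp only: pair_product_def prod.empty)
    then show ?thesis using True vacancy_singleton by simp
  next
    case False
    then obtain b where b: "b \<in> J" "b \<noteq> a" using a by blast
    define K where "K = J - {a, b}"
    have J: "J = insert a (insert b K)" and K: "finite K" "a \<notin> K" "b \<notin> K"
      using a b less.prems by (auto simp: K_def)
    have inj: "inj_on y (insert a (insert b K))" using less.prems J by simp
    have "y a \<notin> y ` K" "y b \<notin> y ` K" "y a \<noteq> y b" using inj K b by (auto simp: inj_on_def)
    then have two: "(qpow (y b) - qpow (y a)) * vacancy (y ` J) =
        qpow (y b) * vacancy (y ` insert b K) - qpow (y a) * vacancy (y ` insert a K)"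
      using vacancy_two_term[of "y ` K" "y a" "y b"] K J by simp
    obtain u where u: "laurent_polynomial u" "pair_factor (y a) (y b) = u * (qpow (y b) - qpow (y a))"
      using pair_factor_unit by blast
    let ?A = "\<Prod>i\<in>K. pair_factor (y a) (y i)" and ?B = "\<Prod>i\<in>K. pair_factor (y b) (y i)"
    have "pair_product y J = pair_product y K * ?B * (pair_factor (y a) (y b) * ?A)"
      using K b unfolding J by (simp add: pair_product_insert)
    then have "pair_product y J * \<phi> * vacancy (y ` J) =
        (pair_product y K * ?B * ?A * u * \<phi>) * ((qpow (y b) - qpow (y a)) * vacancy (y ` J))"
      unfolding u by (simp only: mult_ac)
    \<comment> \<open>Dropping \<open>a\<close> leaves its factors \<open>?A\<close> as a Laurent
      polynomial coefficient, and dropping \<open>b\<close> leaves \<open>?B\<close>.\<close>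
    also have "\<dots> = (u * qpow (y b) * ?A) * (pair_product y K * ?B * \<phi> * vacancy (y ` insert b K))
        - (u * qpow (y a) * ?B) * (pair_product y K * ?A * \<phi> * vacancy (y ` insert a K))"
      unfolding two right_diff_distrib by (simp only: mult_ac)
    also have "\<dots> = (u * qpow (y b) * ?A) * (pair_product y (insert b K) * \<phi> * vacancy (y ` insert b K))
        - (u * qpow (y a) * ?B) * (pair_product y (insert a K) * \<phi> * vacancy (y ` insert a K))"
      using K by (simp add: pair_product_insert)
    also have "\<dots> \<in> theta_module"
    proof -
      have h: "pair_product y (insert c K) * \<phi> * vacancy (y ` insert c K) \<in> theta_module" if "c \<in> {a, b}" for c
        using that K b inj by (intro less.hyps) (auto simp: J)
      show ?thesis
        by (intro theta_module_diff theta_module_mult[OF _ h] laurent_polynomial_mult u(1)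
            laurent_pair_factors laurent_polynomial_qpow) simp_all
    qed
    finally show ?thesis .
  qed
qed

section \<open>The trace\<close>

context fermionic_fock
begin

text \<open>Integer indices reduce comparisons of modes to linear integer arithmetic.\<close>

definition psi_mode :: "int \<Rightarrow> 'v \<Rightarrow> 'v" where
  "psi_mode k = \<psi> (of_int k + 1/2)"

definition psi_star_mode :: "int \<Rightarrow> 'v \<Rightarrow> 'v" where
  "psi_star_mode k = \<psi>s (of_int k + 1/2)"

lemma psi_0: "psi_mode k 0 = 0"
  and psi_star_0: "psi_star_mode k 0 = 0"
  and psi_star_diff: "psi_star_mode k (v - w) = psi_star_mode k v - psi_star_mode k w"
  and psi_star_minus: "psi_star_mode k (- v) = - psi_star_mode k v"
proof -
  interpret P: Vector_Spaces.linear scale scale "psi_mode k"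
    unfolding psi_mode_def by (rule linear_psi)
  interpret PS: Vector_Spaces.linear scale scale "psi_star_mode k"
    unfolding psi_star_mode_def by (rule linear_psi_star)
  show "psi_mode k 0 = 0" "psi_star_mode k 0 = 0" "psi_star_mode k (v - w) = psi_star_mode k v - psi_star_mode k w" "psi_star_mode k (- v) = - psi_star_mode k v"
    by (rule P.zero PS.zero PS.diff PS.neg)+
qed

lemma double_eq_0:
  fixes v :: 'v
  assumes "v + v = 0"
  shows "v = 0"
proof -
  have "scale 2 v = 0" using assms scale_left_distrib[of 1 1 v] by simp
  then show ?thesis by simp
qed

lemma psi_psi: "psi_mode j (psi_mode k v) = - psi_mode k (psi_mode j v)"
  and psi_star_psi_star: "psi_star_mode j (psi_star_mode k v) = - psi_star_mode k (psi_star_mode j v)"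
  using anticomm_psi_psi[of j k v] anticomm_star_star[of j k v]
  by (simp_all add: psi_mode_def psi_star_mode_def eq_neg_iff_add_eq_0)

lemma psi_star_psi: "psi_star_mode l (psi_mode k v) = (if l + k + 1 = 0 then v else 0) - psi_mode k (psi_star_mode l v)"
  and psi_psi_star: "psi_mode k (psi_star_mode l v) = (if l + k + 1 = 0 then v else 0) - psi_star_mode l (psi_mode k v)"
  using anticomm_star_psi[of l k v] unfolding psi_mode_def psi_star_mode_def
  by (simp_all only: eq_diff_eq add.commute)

lemma psi_mode_twice: "psi_mode k (psi_mode k v) = 0" and psi_star_mode_twice: "psi_star_mode k (psi_star_mode k v) = 0"
  unfolding psi_mode_def psi_star_mode_def
  by (rule double_eq_0[OF anticomm_psi_psi], rule double_eq_0[OF anticomm_star_star])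

text \<open>Site \<open>x\<close> is filled and emptied again, which makes this the projection onto
  states vacant at \<open>x\<close>.\<close>

definition vacancy_op :: "int \<Rightarrow> 'v \<Rightarrow> 'v" where
  "vacancy_op x v = psi_star_mode x (psi_mode (- x - 1) v)"

lemma vacancy_op_0: "vacancy_op x 0 = 0"
  by (simp add: vacancy_op_def psi_0 psi_star_0)

text \<open>Passing both factors costs two signs, which cancel; for \<open>j = - x - 1\<close> the
  mode squares to zero.\<close>

lemma vacancy_op_psi: "vacancy_op x (psi_mode j v) = (if j = - x - 1 then 0 else psi_mode j (vacancy_op x v))"
proof (cases "j = - x - 1")
  case True
  then show ?thesis by (simp add: vacancy_op_def psi_mode_twice psi_star_0)
next
  case False
  then have "x + j + 1 \<noteq> 0" by linarith
  then show ?thesis using False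
    by (simp add: vacancy_op_def psi_psi[of "- x - 1" j] psi_star_minus psi_star_psi[of x j])
qed

text \<open>For \<open>j = x\<close> the anticommutator contributes \<open>v\<close>, and the
  remaining term dies because \<open>psi_star_mode x\<close> squares to zero.\<close>

lemma vacancy_op_psi_star: "vacancy_op x (psi_star_mode j v) = (if j = x then psi_star_mode j v else psi_star_mode j (vacancy_op x v))"
  using psi_psi_star[of "- x - 1" j v]
  by (cases "j = x") (simp_all add: vacancy_op_def psi_star_diff psi_star_minus psi_star_mode_twice psi_star_psi_star[of x j])

lemma vacancy_op_vac: "vacancy_op x vac = (if x \<ge> 0 then vac else 0)"
proof (cases "x \<ge> 0")
  case True
  then show ?thesis using psi_star_psi[of x "- x - 1" vac] psi_star_vac[of x]
    by (simp add: vacancy_op_def psi_0 flip: psi_star_mode_def)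
next
  case False
  then show ?thesis using psi_vac[of "- x - 1"]
    by (simp add: vacancy_op_def psi_star_0 flip: psi_mode_def del: of_int_diff of_int_minus)
qed

lemma creation_eq: "\<psi> (- of_nat k - 1/2) = psi_mode (- int k - 1)" "\<psi>s (- of_nat k - 1/2) = psi_star_mode (- int k - 1)"
proof -
  have "(of_int (- int k - 1) + 1/2 :: rat) = - of_nat k - 1/2" by simp
  then show "\<psi> (- of_nat k - 1/2) = psi_mode (- int k - 1)" "\<psi>s (- of_nat k - 1/2) = psi_star_mode (- int k - 1)"
    unfolding psi_mode_def psi_star_mode_def by (simp_all only:)
qed

lemma fold_psi_0: "fold (\<lambda>n. psi_mode (- int n - 1)) ns 0 = 0"
  and fold_psi_star_0: "fold (\<lambda>m. psi_star_mode (- int m - 1)) ns 0 = 0"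
  by (induction ns) (simp_all add: psi_0 psi_star_0)

lemma vacancy_op_fold_psi:
  "vacancy_op x (fold (\<lambda>n. psi_mode (- int n - 1)) ns w) =
     (if x \<in> int ` set ns then 0 else fold (\<lambda>n. psi_mode (- int n - 1)) ns (vacancy_op x w))"
  \<comment> \<open>\<open>fold\<close> applies the last element outermost, hence induction from the
    end of the list.\<close>
  by (induction ns rule: rev_induct)
    (auto simp: vacancy_op_psi psi_0)

lemma vacancy_op_fold_psi_star:
  "vacancy_op x (fold (\<lambda>m. psi_star_mode (- int m - 1)) ms w) =
     (if x \<in> (\<lambda>m. - int m - 1) ` set ms then fold (\<lambda>m. psi_star_mode (- int m - 1)) ms w
      else fold (\<lambda>m. psi_star_mode (- int m - 1)) ms (vacancy_op x w))"
  by (induction ms rule: rev_induct)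
    (auto simp: vacancy_op_psi_star)

text \<open>The operator moves inwards until it meets the mode of site \<open>x\<close>: a
  \<open>\<psi>\<close> annihilates the result, a \<open>\<psi>s\<close> absorbs the operator. If it
  meets neither, the vacuum decides by the sign of \<open>x\<close>.\<close>

lemma vacancy_op_monomial:
  assumes "finite N" "finite M"
  shows "vacancy_op x (monomial N M) = (if vacant x N M then monomial N M else 0)"
proof -
  have "x \<in> int ` N \<longleftrightarrow> x \<ge> 0 \<and> nat x \<in> N"
    by (auto simp: image_iff) (metis int_nat_eq)
  moreover have "x \<in> (\<lambda>m. - int m - 1) ` M \<longleftrightarrow> x < 0 \<and> nat (- x - 1) \<in> M"
    by (auto simp: image_iff intro!: bexI[of _ "nat (- x - 1)"])
  ultimately show ?thesis using assms
    unfolding fock_monomial_def creation_eq vacancy_op_fold_psi vacancy_op_fold_psi_star vacancy_op_vac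
    by (auto simp: vacant_def fold_psi_0 fold_psi_star_0)
qed

lemma A_coeff_eq: "A_coeff (- of_int x - 1/2) = vacancy_op x"
proof
  fix v
  have "(of_int (- x - 1) + 1/2 :: rat) = - of_int x - 1/2" "(of_int x + 1/2 :: rat) = - (- of_int x - 1/2)"
    by simp_all
  moreover have "\<exists>l::int. (- of_int x - 1/2 :: rat) = - of_int l - 1/2" by blast
  ultimately show "A_coeff (- of_int x - 1/2) v = vacancy_op x v"
    unfolding A_coeff_def vacancy_op_def psi_mode_def psi_star_mode_def by (simp only: if_True)
qed

lemma foldr_vacancy_op_monomial:
  assumes "finite N" "finite M"
  shows "foldr (\<lambda>j. vacancy_op (y j)) js (monomial N M) =
    (if \<forall>j\<in>set js. vacant (y j) N M then monomial N M else 0)"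
  by (induction js) (simp_all add: vacancy_op_monomial[OF assms] vacancy_op_0)

text \<open>All diagonal entries are 0 or 1, so the trace counts states.\<close>

lemma trace_vacancy_ops:
  "trace_charge0 (foldr (\<lambda>j. vacancy_op (y j)) js) = vacancy_series (y ` set js)"
proof (rule fps_ext)
  fix d
  let ?V = "\<lambda>(N, M). \<forall>j\<in>set js. vacant (y j) N M"
  have indep: "independent monomials"
    using independent_monomials by (simp add: monomials_def)
  have rep: "representation monomials (foldr (\<lambda>j. vacancy_op (y j)) js (monomial N M)) (monomial N M) =
      (if ?V (N, M) then 1 else 0)" if "(N, M) \<in> charge0_states d" for N M
  proof -
    have fin: "finite N" "finite M" using that by (simp_all add: charge0_states_def)
    then have "monomial N M \<in> monomials" by (auto simp: monomials_def)
    then show ?thesis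
      by (simp add: foldr_vacancy_op_monomial[OF fin] representation_basis[OF indep] representation_zero)
  qed
  have "trace_charge0 (foldr (\<lambda>j. vacancy_op (y j)) js) $ d =
      (\<Sum>a\<in>charge0_states d. if ?V a then 1 else 0)"
    unfolding trace_charge0_def fps_nth_Abs_fps
    by (intro sum.cong refl, clarify) (simp only: rep prod.case)
  also have "\<dots> = of_nat (card {a \<in> charge0_states d. ?V a})"
    by (simp add: finite_charge0_states sum.If_cases Int_def)
  also have "{a \<in> charge0_states d. ?V a} = {(N, M) \<in> charge0_states d. \<forall>x\<in>y ` set js. vacant x N M}"
    by auto
  finally show "trace_charge0 (foldr (\<lambda>j. vacancy_op (y j)) js) $ d = vacancy_series (y ` set js) $ d"
    by (simp add: vacancy_series_def)
qed

text \<open>Site \<open>x\<close> belongs to the exponent \<open>- x - 1/2\<close>: thus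
  \<open>r j + 1/2\<close> gives \<open>x = - r j - 1\<close>, and \<open>- s j - 1/2\<close> gives
  \<open>x = s j\<close>.\<close>

lemma G_eq:
  "G n m r s = euler_phi * vacancy_series ((\<lambda>j. if j \<le> m then - int (r j) - 1 else int (s j)) ` {1..n})"
proof -
  let ?y = "\<lambda>j. if j \<le> m then - int (r j) - 1 else int (s j)"
  have "(if j \<le> m then of_nat (r j) + 1/2 else - of_nat (s j) - 1/2 :: rat) = - of_int (?y j) - 1/2" for j
    by simp
  then have "G n m r s = euler_phi * trace_charge0 (foldr (\<lambda>j. vacancy_op (?y j)) [1..<Suc n])"
    unfolding G_def npoint_coeff_def euler_phi_def by (simp only: A_coeff_eq)
  then show ?thesis
    unfolding trace_vacancy_ops by (simp only: set_upt atLeastLessThanSuc_atLeastAtMost)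
qed

end

text \<open>The three products collect the pairs of indices separated by \<open>m\<close>, both at
  most \<open>m\<close>, and both above \<open>m\<close>. Each exponent is the distance between the
  two sites; strict decrease makes the subtractions of naturals exact.\<close>

lemma pair_product_index_eq:
  fixes r s :: "nat \<Rightarrow> nat"
  assumes m: "m \<le> n"
    and r: "monotone_on {1..m} (<) (>) r"
    and s: "monotone_on {m + 1..n} (<) (>) s"
  defines "y \<equiv> \<lambda>j. if j \<le> m then - int (r j) - 1 else int (s j)"
  shows "fps_to_fls
     ((\<Prod>j=1..m. \<Prod>k=m+1..n. 1 - fps_X ^ (r j + s k + 1)) *
      (\<Prod>(k, l)\<in>{(k, l). 1 \<le> k \<and> k < l \<and> l \<le> m}. 1 - fps_X ^ (r k - r l)) *
      (\<Prod>(k, l)\<in>{(k, l). m + 1 \<le> k \<and> k < l \<and> l \<le> n}. 1 - fps_X ^ (s k - s l))) =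
    pair_product y {1..n}"
proof -
  let ?g = "\<lambda>(k, l). pair_factor (y k) (y l)"
  let ?R = "{(k, l). 1 \<le> k \<and> k < l \<and> l \<le> m}" and ?S = "{(k, l). m + 1 \<le> k \<and> k < l \<and> l \<le> n}"
  let ?T = "{1..m} \<times> {m + 1..n}"
  have fin: "finite ?R" "finite ?S" "finite ?T"
    by (auto intro: finite_subset[of _ "{..n} \<times> {..n}"] finite_subset[of _ "{..m} \<times> {..m}"])
  have "{(k, l). k \<in> {1..n} \<and> l \<in> {1..n} \<and> k < l} = ?T \<union> ?R \<union> ?S"
    using m by auto
  then have "pair_product y {1..n} = prod ?g (?T \<union> ?R \<union> ?S)"
    by (simp only: pair_product_def)
  also have "\<dots> = prod ?g (?T \<union> ?R) * prod ?g ?S"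
    using fin by (intro prod.union_disjoint) auto
  also have "prod ?g (?T \<union> ?R) = prod ?g ?T * prod ?g ?R"
    using fin by (intro prod.union_disjoint) auto
  also have "prod ?g ?T = fps_to_fls (\<Prod>j=1..m. \<Prod>k=m+1..n. 1 - fps_X ^ (r j + s k + 1))"
    unfolding fps_to_fls_prod prod.cartesian_product
    by (intro prod.cong) (auto simp: pair_factor_def y_def fps_to_fls_X_power algebra_simps simp del: power_Suc power_add)
  also have "prod ?g ?R = fps_to_fls (\<Prod>(k, l)\<in>?R. 1 - fps_X ^ (r k - r l))"
  proof -
    have "pair_factor (y k) (y l) = fps_to_fls (1 - fps_X ^ (r k - r l))"
      if "1 \<le> k" "k < l" "l \<le> m" for k l
      using that monotone_onD[OF r, of k l] by (simp add: pair_factor_def y_def fps_to_fls_X_power)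
    then show ?thesis
      unfolding fps_to_fls_prod by (intro prod.cong refl, clarify) (simp only: prod.case)
  qed
  also have "prod ?g ?S = fps_to_fls (\<Prod>(k, l)\<in>?S. 1 - fps_X ^ (s k - s l))"
  proof -
    have "pair_factor (y k) (y l) = fps_to_fls (1 - fps_X ^ (s k - s l))"
      if "m + 1 \<le> k" "k < l" "l \<le> n" for k l
      using that monotone_onD[OF s, of k l] by (simp add: pair_factor_def y_def fps_to_fls_X_power)
    then show ?thesis
      unfolding fps_to_fls_prod by (intro prod.cong refl, clarify) (simp only: prod.case)
  qed
  finally show ?thesis by (simp add: fls_times_fps_to_fls)
qed

theorem theorem1p2:
  fixes scale :: "complex \<Rightarrow> 'v::ab_group_add \<Rightarrow> 'v"
    and \<psi> \<psi>s :: "rat \<Rightarrow> 'v \<Rightarrow> 'v" and vac :: 'v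
    and n m :: nat and r s :: "nat \<Rightarrow> nat"
  assumes fock: "fermionic_fock scale \<psi> \<psi>s vac"
    and n: "n \<ge> 1" and m: "m \<le> n"
    and r: "\<And>j k. 1 \<le> j \<Longrightarrow> j < k \<Longrightarrow> k \<le> m \<Longrightarrow> r j > r k"
    and s: "\<And>j k. m + 1 \<le> j \<Longrightarrow> j < k \<Longrightarrow> k \<le> n \<Longrightarrow> s j > s k"
    and rs: "\<And>j k. 1 \<le> j \<Longrightarrow> j \<le> m \<Longrightarrow> m + 1 \<le> k \<Longrightarrow> k \<le> n \<Longrightarrow>
               - (of_nat (r j) :: rat) - 1/2 \<noteq> of_nat (s k) + 1/2"
  shows "\<exists>!PQ. case PQ of (P, Q) \<Rightarrow>
           laurent_polynomial P \<and> laurent_polynomial Q \<and>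
           fps_to_fls
             ((\<Prod>j=1..m. \<Prod>k=m+1..n. 1 - fps_X ^ (r j + s k + 1)) *
              (\<Prod>(k, l)\<in>{(k, l). 1 \<le> k \<and> k < l \<and> l \<le> m}. 1 - fps_X ^ (r k - r l)) *
              (\<Prod>(k, l)\<in>{(k, l). m + 1 \<le> k \<and> k < l \<and> l \<le> n}. 1 - fps_X ^ (s k - s l)) *
              fermionic_fock.G scale \<psi> \<psi>s vac n m r s)
           = P * fps_to_fls partial_theta + Q"
proof -
  let ?y = "\<lambda>j. if j \<le> m then - int (r j) - 1 else int (s j)"
  \<comment> \<open>Sites from \<open>r\<close> are negative and those from \<open>s\<close> are
    not; within each family strict decrease separates them.\<close>
  have "?y j \<noteq> ?y k" if "j \<in> {1..n}" "k \<in> {1..n}" "j < k" for j k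
    using that r[of j k] s[of j k] by auto
  then have "inj_on ?y {1..n}"
    by (intro linorder_inj_onI) auto
  then have mem: "pair_product ?y {1..n} * \<phi> * vacancy (?y ` {1..n}) \<in> theta_module"
    using n by (intro pair_product_vacancy) auto
  have "monotone_on {1..m} (<) (>) r" "monotone_on {m + 1..n} (<) (>) s"
    using r s by (auto simp: monotone_on_def)
  from mem[folded pair_product_index_eq[OF m this]] show ?thesis
    unfolding fermionic_fock.G_eq[OF fock]
    by (intro theta_module_unique) (simp only: fls_times_fps_to_fls mult.assoc)
qed

end
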